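(* Let $\lambda>1$ be a natural number, consider the rattleback system on $\mathbb{R}^3$ $$\dot x=\lambda xz,\qquad \dot y=-yz,\qquad \dot z=y^2-\lambda x^2,$$ and let $\mathcal{EC}(x,y,z):=\left(xy^{\lambda},\tfrac12(x^2+y^2+z^2)\right)$. For $(h,c)\in\operatorname{Im}(\mathcal{EC})$ let $\mathcal{F}_{(h,c)}:=\mathcal{EC}^{-1}(\{(h,c)\})\subseteq\mathbb{R}^3$. With the strata $\Sigma^{p,\pm},\Sigma^{s,\pm,\star},\Sigma^{u},\Sigma^{s,0}$ defined in the context, the topology and the dynamical description of the fibers of $\mathcal{EC}$ are as follows. (1) If $(h,c)\in\Sigma^{p,+}$ or $(h,c)\in\Sigma^{p,-}$, then $\mathcal{F}_{(h,c)}$ is homeomorphic to the disjoint union $S^1\amalg S^1$ of two circles, and it is a pair of periodic orbits of the rattleback system. (2) If $(h,c)\in\Sigma^{s,+,\star}$ or $(h,c)\in\Sigma^{s,-,\star}$, then $\mathcal{F}_{(h,c)}$ consists of exactly two distinct points, which are a pair of Lyapunov stable equilibrium states. (3) If $(h,c)\in\Sigma^{u}$, then $\mathcal{F}_{(h,c)}$ is a union of two circles intersecting in exactly two points, and it consists of heteroclinic cycles: the two intersection points are a pair of unstable equilibrium states, and the four remaining open arcs are heteroclinic orbits connecting these two equilibria. (4) If $(h,c)\in\Sigma^{s,0}$, then $\mathcal{F}_{(h,c)}=\{(0,0,0)\}$, a Lyapunov stable equilibrium state.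
   Context: Let $\mathcal{E}^{s,\star}:=\{(M,-M\sqrt\lambda,0),(M,M\sqrt\lambda,0): M\in\mathbb{R},\ M\neq0\}$ (the nontrivial Lyapunov stable equilibria), $\mathcal{E}^{s,0}:=\{(0,0,0)\}$, and $\mathcal{E}^{u}:=\{(0,0,M): M\in\mathbb{R},\ M\neq 0\}$ (the unstable equilibria). The strata are $$\Sigma^{s,-,\star}:=\mathcal{EC}(\mathcal{E}^{s,\star})\cap\{(h,c): h<0,\ c>0\},\qquad \Sigma^{s,+,\star}:=\mathcal{EC}(\mathcal{E}^{s,\star})\cap\{(h,c): h>0,\ c>0\},$$ $$\Sigma^{s,0}:=\mathcal{EC}(\mathcal{E}^{s,0})=\{(0,0)\},\qquad \Sigma^{u}:=\mathcal{EC}(\mathcal{E}^{u}),$$ $$\Sigma^{p,-}:=\left\{(h,c): h^2<\lambda^{\lambda}\left(\tfrac{2}{\lambda+1}\right)^{\lambda+1}c^{\lambda+1},\ h<0,\ c>0\right\},\qquad \Sigma^{p,+}:=\left\{(h,c): h^2<\lambda^{\lambda}\left(\tfrac{2}{\lambda+1}\right)^{\lambda+1}c^{\lambda+1},\ h>0,\ c>0\right\}.$$ A heteroclinic orbit connecting two distinct equilibria $p,q$ is an orbit that tends to one of them as $t\to-\infty$ and to the other as $t\to+\infty$. *)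

theory Defs
  imports "HOL-Analysis.Analysis"
begin

section \<open>Autonomous vector fields\<close>

definition solution_on :: "('a::real_normed_vector \<Rightarrow> 'a) \<Rightarrow> (real \<Rightarrow> 'a) \<Rightarrow> real set \<Rightarrow> bool" where
  "solution_on f \<gamma> J \<longleftrightarrow> (\<forall>t\<in>J. (\<gamma> has_vector_derivative f (\<gamma> t)) (at t within J))"

definition equilibrium :: "('a::real_normed_vector \<Rightarrow> 'a) \<Rightarrow> 'a \<Rightarrow> bool" where
  "equilibrium f p \<longleftrightarrow> f p = 0"

text \<open>
  Quantifying over all solution segments on \<open>{0..T}\<close>, rather than over solutions
  on \<open>{0..}\<close>, means that no completeness of the vector field is presupposed.
\<close>

definition lyapunov_stable :: "('a::real_normed_vector \<Rightarrow> 'a) \<Rightarrow> 'a \<Rightarrow> bool" where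
  "lyapunov_stable f p \<longleftrightarrow> equilibrium f p \<and>
     (\<forall>\<epsilon>>0. \<exists>\<delta>>0. \<forall>T>0. \<forall>\<gamma>. solution_on f \<gamma> {0..T} \<and> dist (\<gamma> 0) p < \<delta> \<longrightarrow>
        (\<forall>t\<in>{0..T}. dist (\<gamma> t) p < \<epsilon>))"

definition unstable_equilibrium :: "('a::real_normed_vector \<Rightarrow> 'a) \<Rightarrow> 'a \<Rightarrow> bool" where
  "unstable_equilibrium f p \<longleftrightarrow> equilibrium f p \<and> \<not> lyapunov_stable f p"

text \<open>
  Orbits are taken to be images of solutions defined on all of \<open>\<real>\<close>. This loses nothing
  for the rattleback field: it is smooth and has the compact invariant sets
  \<open>x\<^sup>2 + y\<^sup>2 + z\<^sup>2 = const\<close>, so each maximal solution is defined for all times.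
\<close>

definition periodic_orbit :: "('a::real_normed_vector \<Rightarrow> 'a) \<Rightarrow> 'a set \<Rightarrow> bool" where
  "periodic_orbit f A \<longleftrightarrow>
     (\<exists>\<gamma> T. solution_on f \<gamma> UNIV \<and> T > 0 \<and> (\<forall>t. \<gamma> (t + T) = \<gamma> t) \<and>
        \<not> \<gamma> constant_on UNIV \<and> A = range \<gamma>)"

definition heteroclinic_orbit_from_to ::
  "('a::real_normed_vector \<Rightarrow> 'a) \<Rightarrow> 'a \<Rightarrow> 'a \<Rightarrow> 'a set \<Rightarrow> bool" where
  "heteroclinic_orbit_from_to f p q A \<longleftrightarrow>
     equilibrium f p \<and> equilibrium f q \<and> p \<noteq> q \<and>
     (\<exists>\<gamma>. solution_on f \<gamma> UNIV \<and> (\<gamma> \<longlongrightarrow> p) at_bot \<and> (\<gamma> \<longlongrightarrow> q) at_top \<and> A = range \<gamma>)"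

definition heteroclinic_orbit_connecting ::
  "('a::real_normed_vector \<Rightarrow> 'a) \<Rightarrow> 'a \<Rightarrow> 'a \<Rightarrow> 'a set \<Rightarrow> bool" where
  "heteroclinic_orbit_connecting f p q A \<longleftrightarrow>
     heteroclinic_orbit_from_to f p q A \<or> heteroclinic_orbit_from_to f q p A"

text \<open>
  A heteroclinic cycle is a closed chain
  \<open>p 0 \<rightarrow> p 1 \<rightarrow> \<dots> \<rightarrow> p (n - 1) \<rightarrow> p 0\<close>
  of distinct equilibria and heteroclinic orbits, \<open>n \<ge> 2\<close>, regarded as a set.
\<close>

definition heteroclinic_cycle :: "('a::real_normed_vector \<Rightarrow> 'a) \<Rightarrow> 'a set \<Rightarrow> bool" where
  "heteroclinic_cycle f H \<longleftrightarrow>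
     (\<exists>(n::nat) p A. n \<ge> 2 \<and> inj_on p {..<n} \<and>
        (\<forall>i<n. heteroclinic_orbit_from_to f (p i) (p (Suc i mod n)) (A i)) \<and>
        H = (\<Union>i<n. insert (p i) (A i)))"


section \<open>The rattleback system\<close>

text \<open>The natural number \<open>l\<close> is the parameter \<open>\<lambda>\<close>.\<close>

definition rattleback :: "nat \<Rightarrow> real^3 \<Rightarrow> real^3" where
  "rattleback l v =
     vector [real l * v$1 * v$3, - (v$2 * v$3), (v$2)^2 - real l * (v$1)^2]"

definition EC :: "nat \<Rightarrow> real^3 \<Rightarrow> real \<times> real" where
  "EC l v = (v$1 * (v$2)^l, ((v$1)^2 + (v$2)^2 + (v$3)^2) / 2)"

definition fiber :: "nat \<Rightarrow> real \<times> real \<Rightarrow> (real^3) set" where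
  "fiber l hc = EC l -` {hc}"

definition E_s_star :: "nat \<Rightarrow> (real^3) set" where
  "E_s_star l = {vector [M, - M * sqrt (real l), 0] | M. M \<noteq> 0}
              \<union> {vector [M, M * sqrt (real l), 0] | M. M \<noteq> 0}"

definition E_s_0 :: "(real^3) set" where
  "E_s_0 = {vector [0, 0, 0]}"

definition E_u :: "(real^3) set" where
  "E_u = {vector [0, 0, M] | M. M \<noteq> 0}"

definition Sigma_s_minus_star :: "nat \<Rightarrow> (real \<times> real) set" where
  "Sigma_s_minus_star l = EC l ` E_s_star l \<inter> {(h, c). h < 0 \<and> c > 0}"

definition Sigma_s_plus_star :: "nat \<Rightarrow> (real \<times> real) set" where
  "Sigma_s_plus_star l = EC l ` E_s_star l \<inter> {(h, c). h > 0 \<and> c > 0}"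

definition Sigma_s_0 :: "nat \<Rightarrow> (real \<times> real) set" where
  "Sigma_s_0 l = EC l ` E_s_0"

definition Sigma_u :: "nat \<Rightarrow> (real \<times> real) set" where
  "Sigma_u l = EC l ` E_u"

definition Sigma_p_minus :: "nat \<Rightarrow> (real \<times> real) set" where
  "Sigma_p_minus l =
     {(h, c). h^2 < real l ^ l * (2 / (real l + 1)) ^ (l + 1) * c ^ (l + 1) \<and> h < 0 \<and> c > 0}"

definition Sigma_p_plus :: "nat \<Rightarrow> (real \<times> real) set" where
  "Sigma_p_plus l =
     {(h, c). h^2 < real l ^ l * (2 / (real l + 1)) ^ (l + 1) * c ^ (l + 1) \<and> h > 0 \<and> c > 0}"


section \<open>The circle\<close>

abbreviation S1 :: "complex set" where
  "S1 \<equiv> sphere 0 1"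

definition two_circles :: "(bool \<times> complex) topology" where
  "two_circles = sum_topology (\<lambda>_. top_of_set S1) UNIV"

end

theory Submission
  imports Defs
begin

text \<open>
  The vector field is tangent to the fibers of the two conserved quantities
  \<open>h = x y^l\<close> and \<open>c = (x\<^sup>2 + y\<^sup>2 + z\<^sup>2) / 2\<close>, so that each fiber is a union of orbits, and the
  fibers are curves or points that can be written down.

  If \<open>h \<noteq> 0\<close>, then \<open>y \<noteq> 0\<close> and \<open>x = h / y^l\<close>, so \<open>y\<close> and \<open>z\<close> are coordinates on the fiber.  Let
  \<open>\<rho> > 0\<close> satisfy \<open>\<rho>^(2 l + 2) = l h\<^sup>2\<close> and put \<open>y\<^sup>2 = \<rho>\<^sup>2 exp s\<close>.  In the coordinates \<open>(s, z)\<close> the system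
  is a mechanical one,
  \<open>s' = - 2 z\<close> and \<open>z' = \<rho>\<^sup>2 (exp s - exp (- l s))\<close>, and energy conservation reads
  \<open>\<rho>\<^sup>2 W(s) + z\<^sup>2 = 2 c - \<rho>\<^sup>2 (1 + 1 / l)\<close> for the potential
  \<open>W(s) = exp s + exp (- l s) / l - (1 + 1 / l)\<close>, whose only critical point is the minimum \<open>W(0) = 0\<close>.
  The decisive point is that \<open>W\<close> is a perfect square: the identity \<open>weighted_geometric_sum\<close> lets
  one extract the factor \<open>(exp s - 1)\<^sup>2\<close> explicitly, so \<open>W = q\<^sup>2\<close> for a continuously differentiable
  bijection \<open>q\<close> of the line with positive derivative (\<open>well_coord\<close>).  In the coordinates
  \<open>(\<rho> q, z)\<close> the level curve is a round circle (\<open>fiber_iff_energy\<close>) on which the system rotates with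
  the positive angular velocity \<open>2 \<rho> q'(s)\<close>.

  Hence, when the radius is positive, each sign of \<open>y\<close> contributes one circle.  It is a single
  periodic orbit because a positive periodic velocity on the line can be
  integrated and inverted (\<open>periodic_velocity_solution\<close>); so the solution is obtained by
  quadrature.  The strict inequality that defines the periodic strata says exactly
  that the radius is positive.  On the strata of nontrivial stable equilibria the radius is zero,
  and each sign of \<open>y\<close> contributes one point, an equilibrium.  An equilibrium in a
  finite fiber is Lyapunov stable because a nearby orbit cannot leave the nearby fibers
  (\<open>isolated_conserved_imp_lyapunov_stable\<close>); this covers the origin as well, whose fiber is a
  single point.

  If \<open>h = 0\<close> and \<open>c = m\<^sup>2 / 2\<close> with \<open>m > 0\<close>, the fiber is the union of the great circles \<open>x = 0\<close> and \<open>y = 0\<close> of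
  the sphere of radius \<open>m\<close>.  They meet in the poles \<open>(0, 0, \<plusminus> m)\<close>, and the four open
  half circles are traced by explicit solutions built from \<open>1 / cosh\<close> and \<open>tanh\<close>, which go
  from the south to the north pole in the plane \<open>x = 0\<close> and back in the plane \<open>y = 0\<close>.  Each pole is
  thus the source of a heteroclinic orbit and is therefore unstable.
\<close>

section \<open>Derivatives of curves in space\<close>

lemma vector_3_axis:
  "vector [a, b, c] = a *\<^sub>R axis 1 1 + b *\<^sub>R axis 2 1 + c *\<^sub>R (axis 3 1 :: real^3)"
  by (simp add: vec_eq_iff forall_3 axis_def)

lemma has_vector_derivative_vector_3:
  assumes "(f has_real_derivative f') (at t within S)" "(g has_real_derivative g') (at t within S)"
    "(k has_real_derivative k') (at t within S)"
  shows "((\<lambda>t. vector [f t, g t, k t] :: real^3) has_vector_derivative vector [f', g', k']) (at t within S)"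
  unfolding vector_3_axis
  using has_vector_derivative_scaleR[OF assms(1) has_vector_derivative_const, of "axis 1 1"]
    has_vector_derivative_scaleR[OF assms(2) has_vector_derivative_const, of "axis 2 1"]
    has_vector_derivative_scaleR[OF assms(3) has_vector_derivative_const, of "axis 3 1"]
  by (auto intro!: has_vector_derivative_add)

lemma has_real_derivative_vec_nth:
  assumes "(\<gamma> has_vector_derivative v) F"
  shows "((\<lambda>t. \<gamma> t $ i) has_real_derivative v $ i) F"
  using bounded_linear.has_vector_derivative[OF bounded_linear_vec_nth assms]
  by (simp add: has_real_derivative_iff_has_vector_derivative)

section \<open>Stability and instability of equilibria\<close>

lemma solution_on_continuous_on: "solution_on f \<gamma> J \<Longrightarrow> continuous_on J \<gamma>"
  unfolding solution_on_def
  by (metis continuous_on_eq_continuous_within has_vector_derivative_continuous)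

text \<open>
  The distance of \<open>F\<close> from the value \<open>F p\<close> has a positive minimum on a small sphere around \<open>p\<close>,
  because the sphere is compact and misses the level set of \<open>p\<close>.  A solution that starts close to \<open>p\<close>
  keeps a value of \<open>F\<close> closer to \<open>F p\<close> than this minimum, so by the intermediate value theorem for the
  distance to \<open>p\<close> it cannot cross the sphere.
\<close>

lemma isolated_conserved_imp_lyapunov_stable:
  fixes f :: "'a::euclidean_space \<Rightarrow> 'a" and F :: "'a \<Rightarrow> 'b::heine_borel"
  assumes eq: "equilibrium f p"
    and contF: "continuous_on UNIV F"
    and conserved: "\<And>\<gamma> T t. solution_on f \<gamma> {0..T} \<Longrightarrow> t \<in> {0..T} \<Longrightarrow> F (\<gamma> t) = F (\<gamma> 0)"
    and "e > 0" and isol: "\<And>v. dist v p \<le> e \<Longrightarrow> F v = F p \<Longrightarrow> v = p"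
  shows "lyapunov_stable f p"
  unfolding lyapunov_stable_def
proof (intro conjI eq allI impI)
  fix \<epsilon> :: real assume "\<epsilon> > 0"
  define r where "r = min \<epsilon> e"
  have r: "r > 0" "r \<le> \<epsilon>" "r \<le> e" using \<open>\<epsilon> > 0\<close> \<open>e > 0\<close> by (auto simp: r_def)
  have "compact (F ` sphere p r)"
    by (intro compact_continuous_image continuous_on_subset[OF contF]) auto
  moreover have "F p \<notin> F ` sphere p r"
    using isol r by (force simp: dist_commute)
  ultimately obtain m where m: "m > 0" "\<And>v. v \<in> sphere p r \<Longrightarrow> m \<le> dist (F p) (F v)"
    using separate_point_closed[of "F ` sphere p r" "F p"] compact_imp_closed by blast
  have "isCont F p" using contF by (simp add: continuous_on_eq_continuous_at)
  then obtain d where d: "d > 0" "\<And>v. dist v p < d \<Longrightarrow> dist (F v) (F p) < m"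
    using \<open>m > 0\<close> unfolding continuous_at_eps_delta by metis
  show "\<exists>\<delta>>0. \<forall>T>0. \<forall>\<gamma>. solution_on f \<gamma> {0..T} \<and> dist (\<gamma> 0) p < \<delta> \<longrightarrow>
        (\<forall>t\<in>{0..T}. dist (\<gamma> t) p < \<epsilon>)"
  proof (intro exI[of _ "min d r"] conjI allI impI ballI)
    show "min d r > 0" using d r by simp
    fix T :: real and \<gamma> t
    assume "T > 0" and sol: "solution_on f \<gamma> {0..T} \<and> dist (\<gamma> 0) p < min d r" and t: "t \<in> {0..T}"
    show "dist (\<gamma> t) p < \<epsilon>"
    proof (rule ccontr)
      assume "\<not> dist (\<gamma> t) p < \<epsilon>"
      then have "r \<le> dist (\<gamma> t) p" using r by linarith
      moreover have "continuous_on {0..t} (\<lambda>s. dist (\<gamma> s) p)"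
        using solution_on_continuous_on[of f \<gamma> "{0..T}"] sol t
        by (intro continuous_intros) (auto intro: continuous_on_subset)
      ultimately obtain s where s: "0 \<le> s" "s \<le> t" "dist (\<gamma> s) p = r"
        using IVT'[of "\<lambda>s. dist (\<gamma> s) p" 0 r t] sol t by auto
      then have "F (\<gamma> s) = F (\<gamma> 0)" using conserved[of \<gamma> T s] sol t s by simp
      then have "dist (F (\<gamma> s)) (F p) < m" using d(2)[of "\<gamma> 0"] sol by simp
      moreover have "m \<le> dist (F p) (F (\<gamma> s))" using m(2)[of "\<gamma> s"] s(3) by (simp add: dist_commute)
      ultimately show False by (simp add: dist_commute)
    qed
  qed
qed

text \<open>
  Translated in time, the heteroclinic solution starts as close to \<open>p\<close> as desired and still comes
  close to \<open>q\<close>, hence leaves the ball around \<open>p\<close> whose radius is half the distance of \<open>p\<close> and \<open>q\<close>.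
\<close>

lemma heteroclinic_source_unstable:
  assumes "heteroclinic_orbit_from_to f p q A"
  shows "unstable_equilibrium f p"
proof -
  obtain \<gamma> where g: "equilibrium f p" "p \<noteq> q" "solution_on f \<gamma> UNIV"
      "(\<gamma> \<longlongrightarrow> p) at_bot" "(\<gamma> \<longlongrightarrow> q) at_top"
    using assms unfolding heteroclinic_orbit_from_to_def by blast
  have "\<not> lyapunov_stable f p"
  proof
    assume "lyapunov_stable f p"
    define \<epsilon> where "\<epsilon> = dist p q / 2"
    have "\<epsilon> > 0" using g by (simp add: \<epsilon>_def)
    then obtain \<delta> where d: "\<delta> > 0" "\<And>T \<gamma> t. T > 0 \<Longrightarrow> solution_on f \<gamma> {0..T} \<Longrightarrow> dist (\<gamma> 0) p < \<delta>
        \<Longrightarrow> t\<in>{0..T} \<Longrightarrow> dist (\<gamma> t) p < \<epsilon>"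
      using \<open>lyapunov_stable f p\<close> unfolding lyapunov_stable_def by metis
    obtain t0 where t0: "dist (\<gamma> t0) p < \<delta>"
      using tendstoD[OF g(4) d(1)] by (auto simp: eventually_at_bot_linorder)
    obtain t1 where t1: "\<And>t. t \<ge> t1 \<Longrightarrow> dist (\<gamma> t) q < \<epsilon>"
      using tendstoD[OF g(5) \<open>\<epsilon> > 0\<close>] by (auto simp: eventually_at_top_linorder)
    define T where "T = max 1 (t1 - t0)"
    have "solution_on f (\<lambda>t. \<gamma> (t0 + t)) {0..T}"
      unfolding solution_on_def
    proof
      fix t
      have "(\<gamma> has_vector_derivative f (\<gamma> (t0 + t))) (at (t0 + t))"
        using g(3) by (simp add: solution_on_def)
      then have "((\<gamma> \<circ> (\<lambda>t. t0 + t)) has_vector_derivative 1 *\<^sub>R f (\<gamma> (t0 + t))) (at t)"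
        by (intro vector_diff_chain_at) (auto intro!: derivative_eq_intros)
      then show "((\<lambda>t. \<gamma> (t0 + t)) has_vector_derivative f (\<gamma> (t0 + t))) (at t within {0..T})"
        by (auto simp: o_def intro: has_vector_derivative_at_within)
    qed
    from d(2)[OF _ this, of T] t0 have "dist (\<gamma> (t0 + T)) p < \<epsilon>" by (simp add: T_def)
    moreover have "dist (\<gamma> (t0 + T)) q < \<epsilon>" by (rule t1) (simp add: T_def)
    ultimately show False
      using dist_triangle2[of p q "\<gamma> (t0 + T)"] by (simp add: \<epsilon>_def dist_commute)
  qed
  with g show ?thesis by (simp add: unstable_equilibrium_def)
qed

lemma EC_conserved:
  assumes sol: "solution_on (rattleback l) \<gamma> {0..T}" and t: "t \<in> {0..T}"
  shows "EC l (\<gamma> t) = EC l (\<gamma> 0)"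
proof -
  let ?D = "\<lambda>g t g'. (g has_real_derivative g') (at t within {0..T})"
  have d: "?D (\<lambda>t. \<gamma> t $ 1) s (real l * \<gamma> s $ 1 * \<gamma> s $ 3)" 
    "?D (\<lambda>t. \<gamma> t $ 2) s (- (\<gamma> s $ 2 * \<gamma> s $ 3))"
    "?D (\<lambda>t. \<gamma> t $ 3) s ((\<gamma> s $ 2)\<^sup>2 - real l * (\<gamma> s $ 1)\<^sup>2)" if "s \<in> {0..T}" for s
  proof -
    have "(\<gamma> has_vector_derivative rattleback l (\<gamma> s)) (at s within {0..T})"
      using sol that by (simp add: solution_on_def)
    note der = has_real_derivative_vec_nth[OF this]
    show "?D (\<lambda>t. \<gamma> t $ 1) s (real l * \<gamma> s $ 1 * \<gamma> s $ 3)"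
      "?D (\<lambda>t. \<gamma> t $ 2) s (- (\<gamma> s $ 2 * \<gamma> s $ 3))"
      "?D (\<lambda>t. \<gamma> t $ 3) s ((\<gamma> s $ 2)\<^sup>2 - real l * (\<gamma> s $ 1)\<^sup>2)"
      using der[of 1] der[of 2] der[of 3] by (simp_all add: rattleback_def)
  qed
  have h: "?D (\<lambda>t. \<gamma> t $ 1 * (\<gamma> t $ 2) ^ l) s 0" if "s \<in> {0..T}" for s
    by (rule derivative_eq_intros d that refl)+ (cases l; simp add: algebra_simps)
  have c: "?D (\<lambda>t. ((\<gamma> t $ 1)\<^sup>2 + (\<gamma> t $ 2)\<^sup>2 + (\<gamma> t $ 3)\<^sup>2) / 2) s 0" if "s \<in> {0..T}" for s
  proof -
    have "?D (\<lambda>t. (\<gamma> t $ 1)\<^sup>2 + (\<gamma> t $ 2)\<^sup>2 + (\<gamma> t $ 3)\<^sup>2) s 0"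
      by (rule derivative_eq_intros d that refl)+ (simp add: algebra_simps power2_eq_square)
    from DERIV_cdivide[OF this, of 2] show ?thesis by simp
  qed
  have "0 \<in> {0..T}" using t by simp
  have const: "g t = g 0" if "\<And>s. s \<in> {0..T} \<Longrightarrow> ?D g s 0" for g
    using has_field_derivative_zero_constant[OF convex_real_interval(5) that] t \<open>0 \<in> {0..T}\<close>
    by metis
  show ?thesis
    unfolding EC_def using const[OF h] const[OF c] by simp
qed

lemma isolated_in_fiber_imp_lyapunov_stable:
  assumes "equilibrium (rattleback l) p" and "finite (fiber l (EC l p))"
  shows "lyapunov_stable (rattleback l) p"
proof -
  have cont: "continuous_on UNIV (EC l)"
    unfolding EC_def by (intro continuous_intros) auto
  obtain e where e: "e > 0" "\<And>v. v \<in> fiber l (EC l p) \<Longrightarrow> v \<noteq> p \<Longrightarrow> e \<le> dist p v"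
    using finite_set_avoid[OF assms(2), of p] by metis
  show ?thesis
  proof (rule isolated_conserved_imp_lyapunov_stable[OF assms(1) cont])
    show "EC l (\<gamma> t) = EC l (\<gamma> 0)"
      if "solution_on (rattleback l) \<gamma> {0..T}" "t \<in> {0..T}" for \<gamma> T t
      using that by (rule EC_conserved)
    show "e / 2 > 0" using e by simp
    show "v = p" if "dist v p \<le> e / 2" "EC l v = EC l p" for v
      using e(1) e(2)[of v] that by (force simp: fiber_def dist_commute)
  qed
qed

section \<open>Topology of disjoint pieces\<close>

text \<open>
  A piece is also closed in \<open>S\<close>, being the complement of the union of the other pieces, and a connected
  subset of \<open>S\<close> cannot be split by a clopen set.
\<close>

lemma components_eq_if_disjoint_open:
  fixes S :: "'a::topological_space set"
  assumes U: "\<Union>\<A> = S" and disj: "pairwise disjnt \<A>"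
    and op: "\<And>A. A \<in> \<A> \<Longrightarrow> openin (top_of_set S) A"
    and conn: "\<And>A. A \<in> \<A> \<Longrightarrow> connected A" and ne: "{} \<notin> \<A>"
  shows "components S = \<A>"
proof -
  have *: "connected_component_set S x = A" if "A \<in> \<A>" "x \<in> A" for A x
  proof
    show "A \<subseteq> connected_component_set S x"
      using that conn U by (intro connected_component_maximal) auto
    define C where "C = connected_component_set S x"
    have C: "connected C" "C \<subseteq> S" "x \<in> C"
      using that U by (auto simp: C_def connected_component_subset connected_component_refl)
    have "S - A = \<Union>(\<A> - {A})"
      using U disj that by (auto simp: pairwise_def disjnt_iff)
    then have "openin (top_of_set S) (S - A)"
      using op by (metis DiffD1 openin_Union)
    then obtain V where V: "open V" "S - A = S \<inter> V" by (metis openin_open)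
    obtain W where W: "open W" "A = S \<inter> W" using op[OF \<open>A \<in> \<A>\<close>] by (metis openin_open)
    have "C \<inter> W \<noteq> {}" using W that C by blast
    moreover have "C \<inter> W \<inter> V = {}" "C \<subseteq> W \<union> V" using V W C by blast+
    ultimately have "C \<inter> V = {}"
      using C(1) W(1) V(1) unfolding connected_def by blast
    then show "connected_component_set S x \<subseteq> A"
      using \<open>C \<subseteq> W \<union> V\<close> C W unfolding C_def by blast
  qed
  show ?thesis
  proof (intro equalityI subsetI)
    fix A assume "A \<in> components S" then show "A \<in> \<A>"
      using * U by (metis UnionE components_iff)
  next
    fix A assume A: "A \<in> \<A>" then obtain x where "x \<in> A" using ne by (metis ex_in_conv)
    then show "A \<in> components S"
      using *[OF A] A U by (metis UnionI components_iff)
  qed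
qed

text \<open>
  The two parametrizations glue to a continuous bijection from a compact space onto a Hausdorff
  space.
\<close>

lemma homeomorphic_space_two_circles:
  fixes A B :: "'a::metric_space set"
  assumes A: "S1 homeomorphic A" and B: "S1 homeomorphic B" and disj: "A \<inter> B = {}"
  shows "top_of_set (A \<union> B) homeomorphic_space two_circles"
proof -
  obtain f f' where f: "homeomorphism S1 A f f'" using A by (auto simp: homeomorphic_def)
  obtain g g' where g: "homeomorphism S1 B g g'" using B by (auto simp: homeomorphic_def)
  let ?k = "\<lambda>(b, w). if b then f w else g w"
  have im: "f ` S1 = A" "g ` S1 = B" and cont: "continuous_on S1 f" "continuous_on S1 g"
    and inj: "inj_on f S1" "inj_on g S1"
    using f g inj_on_inverseI[of S1 f' f] inj_on_inverseI[of S1 g' g]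
    unfolding homeomorphism_def by blast+
  have top: "topspace two_circles = UNIV \<times> S1" by (simp add: two_circles_def comp_def)
  have "homeomorphic_map two_circles (top_of_set (A \<union> B)) ?k"
  proof (rule continuous_imp_homeomorphic_map)
    have pre: "openin (top_of_set S1) {w \<in> S1. k w \<in> U}"
      if "continuous_on S1 k" "k ` S1 \<subseteq> A \<union> B" "openin (top_of_set (A \<union> B)) U" for k U
      using continuous_openin_preimage[OF that(1) _ that(3)] that(2)
      by (simp only: image_subset_iff_funcset vimage_def Int_def mem_Collect_eq)
    show "continuous_map two_circles (top_of_set (A \<union> B)) ?k"
      unfolding continuous_map_def
    proof (intro conjI allI impI)
      show "?k \<in> topspace two_circles \<rightarrow> topspace (top_of_set (A \<union> B))"
        using im by (auto simp: top)
      fix U assume U: "openin (top_of_set (A \<union> B)) U"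
      show "openin two_circles {x \<in> topspace two_circles. ?k x \<in> U}"
        unfolding top unfolding two_circles_def openin_sum_topology
      proof (intro conjI ballI)
        fix b :: bool
        show "openin (top_of_set S1) {w. (b, w) \<in> {x \<in> UNIV \<times> S1. ?k x \<in> U}}"
          using pre[OF cont(1) _ U] pre[OF cont(2) _ U] im by (cases b) (simp_all add: conj_commute)
      qed auto
    qed
    have "compactin two_circles (Pair b ` S1)" for b
      unfolding two_circles_def
      by (rule image_compactin[OF _ continuous_map_component_injection])
         (auto simp: compactin_subtopology)
    from compactin_Un[OF this[of True] this[of False]]
    have "compactin two_circles (Pair True ` S1 \<union> Pair False ` S1)" .
    moreover have "Pair True ` S1 \<union> Pair False ` S1 = topspace two_circles"
      by (auto simp: top intro: bool.exhaust)
    ultimately show "compact_space two_circles" by (simp add: compact_space_def)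
    show "Hausdorff_space (top_of_set (A \<union> B))"
      by (intro Hausdorff_space_subtopology Hausdorff_space_euclidean)
    show "?k ` topspace two_circles = topspace (top_of_set (A \<union> B))"
      using im by (force simp: top image_iff)
    show "inj_on ?k (topspace two_circles)"
      using inj im disj by (auto simp: top inj_on_def split: if_splits) 
  qed
  then show ?thesis
    using homeomorphic_map_imp_homeomorphic_space homeomorphic_space_sym by blast
qed

section \<open>Periodic orbits from parametrized closed curves\<close>

lemma increasing_C1_bijection_inverse:
  fixes f f' :: "real \<Rightarrow> real"
  assumes der: "\<And>x. (f has_real_derivative f' x) (at x)"
    and pos: "\<And>x. f' x > 0" and sur: "surj f"
  obtains g where "\<And>x. g (f x) = x" "\<And>y. f (g y) = y"
    "\<And>y. (g has_real_derivative 1 / f' (g y)) (at y)"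
proof
  have "strict_mono f"
  proof (rule strict_monoI)
    show "f x < f y" if "x < y" for x y
      using that by (rule DERIV_pos_imp_increasing) (use der pos in metis)
  qed
  then have inj: "inj f" by (rule strict_mono_imp_inj_on)
  show gf: "inv f (f x) = x" for x using inj by simp
  show fg: "f (inv f y) = y" for y using sur by (simp add: surj_f_inv_f)
  show "(inv f has_real_derivative 1 / f' (inv f y)) (at y)" for y
  proof -
    have "isCont (inv f) (f (inv f y))"
      by (rule isCont_inverse_function[of 1]) (simp_all add: gf DERIV_isCont[OF der])
    then have "isCont (inv f) y" by (simp add: fg)
    then have "(inv f has_real_derivative inverse (f' (inv f y))) (at y)"
      using DERIV_inverse_function[where f = f and g = "inv f" and x = y and D = "f' (inv f y)"
          and a = "y - 1" and b = "y + 1"] der fg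
        pos[of "inv f y"] by simp
    then show ?thesis by (simp add: inverse_eq_divide)
  qed
qed

text \<open>
  Separation of variables: an antiderivative \<open>F\<close> of \<open>1 / g\<close> is the time needed to reach a position,
  and \<open>\<Theta>\<close> is its inverse.  By periodicity every interval of length \<open>P\<close> takes the same time \<open>T\<close>, which
  makes \<open>F\<close> unbounded in both directions, so that \<open>\<Theta>\<close> is defined for all times and is onto.
\<close>

lemma periodic_velocity_solution:
  fixes g :: "real \<Rightarrow> real"
  assumes cont: "\<And>x. isCont g x" and pos: "\<And>x. g x > 0"
    and P: "P > 0" and per: "\<And>x. g (x + P) = g x"
  obtains \<Theta> T where "\<And>t. (\<Theta> has_real_derivative g (\<Theta> t)) (at t)" "surj \<Theta>"
    "T > 0" "\<And>t. \<Theta> (t + T) = \<Theta> t + P"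
proof -
  \<comment> \<open>The interval with infinite endpoints yields an antiderivative on the whole line.\<close>
  have "\<exists>F. \<forall>x::real. -\<infinity> < ereal x \<longrightarrow> ereal x < \<infinity> \<longrightarrow> (F has_vector_derivative 1 / g x) (at x)"
    by (rule einterval_antiderivative) (auto intro!: continuous_intros cont simp: pos[THEN less_imp_neq, symmetric])
  then obtain F where F: "(F has_real_derivative 1 / g x) (at x)" for x
    by (auto simp: has_real_derivative_iff_has_vector_derivative)
  define T where "T = F P - F 0"
  have mono: "F x < F y" if "x < y" for x y
    using that by (rule DERIV_pos_imp_increasing) (metis F pos zero_less_divide_1_iff)
  have "T > 0" using mono P by (simp add: T_def)
  have "((\<lambda>x. F (x + P) - F x) has_real_derivative 0) (at x)" for x
  proof -
    have "((\<lambda>x. F (x + P)) has_real_derivative 1 / g (x + P)) (at x)"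
      using F[of "x + P"] by (simp add: DERIV_shift)
    from DERIV_diff[OF this F[of x]] show ?thesis by (simp add: per)
  qed
  then have "F (x + P) - F x = F (0 + P) - F 0" for x
    by (intro DERIV_isconst_all) auto
  from this have shift: "F (x + P) = F x + T" for x
    unfolding T_def by (metis add.commute add_0 diff_add_cancel)
  have shift_nat: "F (x + real n * P) = F x + real n * T" for x n
  proof (induction n)
    case (Suc n)
    then show ?case using shift[of "x + real n * P"] by (simp add: algebra_simps)
  qed simp
  have contF: "isCont F x" for x by (rule DERIV_isCont[OF F])
  have "surj F"
  proof (rule surjI)
    fix y
    obtain n :: nat where n: "\<bar>y - F 0\<bar> < real n * T"
      using reals_Archimedean3[OF \<open>T > 0\<close>] by blast
    have "F (- real n * P) = F 0 - real n * T"
      using shift_nat[of "- real n * P" n] by simp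
    then have "\<exists>x. - real n * P \<le> x \<and> x \<le> real n * P \<and> F x = y"
      using n shift_nat[of 0 n] P by (intro IVT) (auto intro: contF order_trans[of _ 0])
    then show "F (SOME x. F x = y) = y" by (metis (mono_tags, lifting) someI)
  qed
  then obtain \<Theta> where \<Theta>: "\<And>x. \<Theta> (F x) = x" "\<And>y. F (\<Theta> y) = y"
    "\<And>y. (\<Theta> has_real_derivative 1 / (1 / g (\<Theta> y))) (at y)"
    using increasing_C1_bijection_inverse[of F "\<lambda>x. 1 / g x"] F pos by auto
  show ?thesis
  proof
    show "(\<Theta> has_real_derivative g (\<Theta> t)) (at t)" for t using \<Theta>(3)[of t] by simp
    show "surj \<Theta>" using \<Theta>(1) by (rule surjI)
    show "\<Theta> (t + T) = \<Theta> t + P" for t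
      using \<Theta>(1)[of "\<Theta> t + P"] by (simp add: shift \<Theta>(2))
  qed fact
qed

text \<open>
  This turns a geometric description of a closed curve into an orbit: if the field is a
  positive multiple \<open>g\<close> of the velocity of the parametrization, only the parameter has to be
  reparametrized by time, which is a one-dimensional problem.
\<close>

lemma periodic_orbit_if_parametrized:
  fixes f :: "'a::real_normed_vector \<Rightarrow> 'a" and \<phi> :: "real \<Rightarrow> 'a"
  assumes cont: "\<And>\<theta>. isCont g \<theta>" and pos: "\<And>\<theta>. g \<theta> > 0"
    and P: "P > 0" and per_g: "\<And>\<theta>. g (\<theta> + P) = g \<theta>" and per: "\<And>\<theta>. \<phi> (\<theta> + P) = \<phi> \<theta>"
    and der: "\<And>\<theta>. (\<phi> has_vector_derivative \<phi>' \<theta>) (at \<theta>)"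
    and tangent: "\<And>\<theta>. f (\<phi> \<theta>) = g \<theta> *\<^sub>R \<phi>' \<theta>"
    and nonconst: "\<phi> \<theta>\<^sub>1 \<noteq> \<phi> \<theta>\<^sub>2"
  shows "periodic_orbit f (range \<phi>)"
proof -
  obtain \<Theta> T where \<Theta>: "\<And>t. (\<Theta> has_real_derivative g (\<Theta> t)) (at t)" "surj \<Theta>"
    "T > 0" "\<And>t. \<Theta> (t + T) = \<Theta> t + P"
    using periodic_velocity_solution[OF cont pos P per_g] by blast
  have "solution_on f (\<phi> \<circ> \<Theta>) UNIV"
    unfolding solution_on_def
  proof
    fix t
    have "((\<phi> \<circ> \<Theta>) has_vector_derivative g (\<Theta> t) *\<^sub>R \<phi>' (\<Theta> t)) (at t)"
      by (intro vector_diff_chain_at der)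
        (use \<Theta>(1) in \<open>simp add: has_real_derivative_iff_has_vector_derivative\<close>)
    then show "((\<phi> \<circ> \<Theta>) has_vector_derivative f ((\<phi> \<circ> \<Theta>) t)) (at t)"
      by (simp add: tangent)
  qed
  moreover have range: "range (\<phi> \<circ> \<Theta>) = range \<phi>"
    using \<Theta>(2) by (metis image_comp)
  moreover have "\<not> (\<phi> \<circ> \<Theta>) constant_on UNIV"
    using nonconst range unfolding constant_on_def by (metis UNIV_I image_iff rangeI)
  ultimately show ?thesis
    unfolding periodic_orbit_def using \<Theta>(3,4) per
    by (intro exI[of _ "\<phi> \<circ> \<Theta>"] exI[of _ T]) auto
qed

section \<open>The potential well as a square\<close>

text \<open>
  With \<open>u = exp s\<close>, this is the quotient of \<open>W = u + u^(-l) / l - (1 + 1 / l)\<close> by \<open>(u - 1)\<^sup>2\<close>, written so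
  that it makes sense, and is visibly smooth and positive, at the minimum \<open>u = 1\<close> of the potential \<open>W\<close>.
\<close>

definition well_factor :: "nat \<Rightarrow> real \<Rightarrow> real" where
  "well_factor l s = (\<Sum>k<l. real (Suc k) * exp s ^ k) / (real l * exp s ^ l)"

text \<open>
  The square root of the potential \<open>W\<close> with the sign of \<open>s\<close>.
\<close>

definition well_coord :: "nat \<Rightarrow> real \<Rightarrow> real" where
  "well_coord l s = (exp s - 1) * sqrt (well_factor l s)"

text \<open>
  The derivative of \<open>well_coord\<close>, in a form that is positive and continuous also at \<open>s = 0\<close>, where the
  expression \<open>W' / (2 q)\<close> obtained from \<open>q\<^sup>2 = W\<close> is undefined.  It arises from that expression by cancelling
  the factor \<open>exp s - 1\<close>.
\<close>

definition well_coord' :: "nat \<Rightarrow> real \<Rightarrow> real" where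
  "well_coord' l s = (\<Sum>k<Suc l. exp s ^ k) / (2 * exp s ^ l * sqrt (well_factor l s))"

lemma weighted_geometric_sum:
  fixes u :: real
  shows "(u - 1)\<^sup>2 * (\<Sum>k<l. real (Suc k) * u ^ k) = real l * u ^ Suc l - real (Suc l) * u ^ l + 1"
proof (induction l)
  case (Suc l)
  then show ?case by (simp add: algebra_simps power2_eq_square)
qed simp

lemma well_factor_pos: "l > 0 \<Longrightarrow> well_factor l s > 0"
  unfolding well_factor_def
  by (intro divide_pos_pos sum_pos mult_pos_pos) auto

lemma well_coord'_pos: "l > 0 \<Longrightarrow> well_coord' l s > 0"
  unfolding well_coord'_def
  by (intro divide_pos_pos sum_pos mult_pos_pos) (auto simp: well_factor_pos)

lemma well_coord_sq:
  assumes "l > 0"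
  shows "(well_coord l s)\<^sup>2 = exp s + 1 / (real l * exp s ^ l) - (1 + 1 / real l)"
proof -
  have "(well_coord l s)\<^sup>2 = ((exp s - 1)\<^sup>2 * (\<Sum>k<l. real (Suc k) * exp s ^ k)) / (real l * exp s ^ l)"
    using well_factor_pos[OF assms, of s]
    by (simp add: well_coord_def power_mult_distrib well_factor_def)
  also have "\<dots> = exp s + 1 / (real l * exp s ^ l) - (1 + 1 / real l)"
    using assms by (simp only: weighted_geometric_sum) (simp add: field_simps)
  finally show ?thesis .
qed

text \<open>
  Both sides are the derivative of the potential \<open>W\<close>, that is, \<open>z'\<close> in units of \<open>\<rho>\<^sup>2\<close>.
\<close>

lemma well_coord_times_deriv:
  assumes "l > 0"
  shows "2 * well_coord l s * well_coord' l s = exp s - 1 / exp s ^ l"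
proof -
  have "2 * well_coord l s * well_coord' l s
      = ((exp s - 1) * (\<Sum>k<Suc l. exp s ^ k)) / exp s ^ l"
    using well_factor_pos[OF assms, of s]
    by (simp add: well_coord_def well_coord'_def del: sum.lessThan_Suc)
  also have "\<dots> = (exp s ^ Suc l - 1) / exp s ^ l"
    by (simp only: power_diff_1_eq)
  also have "\<dots> = exp s - 1 / exp s ^ l"
    by (simp add: field_simps)
  finally show ?thesis .
qed

text \<open>
  The product rule yields a derivative \<open>D\<close> that contains the derivative \<open>K'\<close> of \<open>well_factor\<close>.  Away from
  \<open>s = 0\<close>, differentiating \<open>q\<^sup>2 = W\<close> determines \<open>D\<close>; at \<open>s = 0\<close> the factor \<open>exp s - 1\<close> removes the term
  with \<open>K'\<close>.
\<close>

lemma has_derivative_well_coord: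
  assumes "l > 0"
  shows "(well_coord l has_real_derivative well_coord' l s) (at s)"
proof -
  have ex: "(exp :: real \<Rightarrow> real) differentiable at s"
    by (metis DERIV_exp real_differentiable_def)
  have "(well_factor l) differentiable at s"
    unfolding well_factor_def[abs_def] using assms by (intro derivative_intros) (auto intro: ex differentiable_power)
  then obtain K' where K': "(well_factor l has_real_derivative K') (at s)"
    by (metis real_differentiable_def)
  define D where "D = exp s * sqrt (well_factor l s)
    + (exp s - 1) * (K' * (inverse (sqrt (well_factor l s)) / 2))"
  have D: "(well_coord l has_real_derivative D) (at s)"
    unfolding well_coord_def[abs_def] D_def using well_factor_pos[OF assms, of s]
    by (auto intro!: derivative_eq_intros K' simp: field_simps)
  have "D = well_coord' l s"
  proof (cases "s = 0")
    case True
    \<comment> \<open>At the minimum the formula for \<open>q'\<close> involves \<open>1 + 2 + \<dots> + l\<close>.\<close>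
    have gauss: "(\<Sum>k<l. real (Suc k)) = real l * (real l + 1) / 2"
      by (induction l) (simp_all add: field_simps)
    have K: "well_factor l 0 = (real l + 1) / 2"
      using assms gauss by (simp add: well_factor_def)
    have "(\<Sum>k<Suc l. exp 0 ^ k) = real l + (1::real)" by simp
    then show ?thesis
      unfolding True D_def well_coord'_def K by (simp add: real_div_sqrt field_simps)
  next
    case False
    have "((\<lambda>s. (well_coord l s)\<^sup>2) has_real_derivative 2 * well_coord l s * D) (at s)"
      by (auto intro!: derivative_eq_intros D)
    moreover have "((\<lambda>s. (well_coord l s)\<^sup>2) has_real_derivative (exp s - 1 / exp s ^ l)) (at s)"
      unfolding well_coord_sq[OF assms] using assms
      by (auto intro!: derivative_eq_intros simp: field_simps exp_of_nat_mult[symmetric] exp_add[symmetric])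
    ultimately have "2 * well_coord l s * D = 2 * well_coord l s * well_coord' l s"
      by (metis DERIV_unique well_coord_times_deriv[OF assms])
    moreover have "well_coord l s \<noteq> 0"
      using False well_factor_pos[OF assms, of s] by (simp add: well_coord_def)
    ultimately show ?thesis by simp
  qed
  with D show ?thesis by simp
qed

text \<open>
  As \<open>q\<^sup>2 = W\<close>, a value \<open>r\<close> is enclosed once \<open>W \<ge> r\<^sup>2\<close> holds at a point on either side of the minimum.  On
  the right the term \<open>exp s\<close> is used, on the left the term \<open>exp (- l s) / l\<close>.
\<close>

lemma surj_well_coord:
  assumes "l > 0"
  shows "surj (well_coord l)"
proof (rule surjI)
  fix r :: real
  have cont: "isCont (well_coord l) s" for s
    using has_derivative_well_coord[OF assms] DERIV_isCont by blast
  \<comment> \<open>The summand 2 absorbs the constant \<open>1 + 1 / l\<close> in the formula for the square.\<close>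
  define b where "b = r\<^sup>2 + 2"
  define a where "a = - ln (real l * b)"
  have l1: "real l \<ge> 1" using assms by simp
  have b: "b \<ge> 2" by (simp add: b_def)
  have lb: "real l * b \<ge> 2" using l1 b mult_mono[of 1 "real l" 2 b] by simp
  have inv_l: "1 / real l \<le> 1" using l1 by simp
  have "r \<le> well_coord l (ln b)"
  proof -
    have "r\<^sup>2 \<le> b + 1 / (real l * b ^ l) - (1 + 1 / real l)"
    proof -
      have "0 \<le> 1 / (real l * b ^ l)" using b by simp
      moreover have "b = r\<^sup>2 + 2" by (rule b_def)
      ultimately show ?thesis using inv_l by linarith
    qed
    then have "r\<^sup>2 \<le> (well_coord l (ln b))\<^sup>2"
      using b well_coord_sq[OF assms, of "ln b"] by simp
    moreover have "0 \<le> well_coord l (ln b)"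
      using b well_factor_pos[OF assms, of "ln b"] by (simp add: well_coord_def)
    ultimately show ?thesis by (simp add: power2_le_iff_abs_le)
  qed
  moreover have "well_coord l a \<le> r"
  proof -
    have ea: "exp a = 1 / (real l * b)"
      using lb by (simp add: a_def exp_minus inverse_eq_divide)
    have "r\<^sup>2 \<le> b - (1 + 1 / real l)"
      using inv_l by (simp add: b_def)
    also have "b = 1 / (real l * exp a)"
      using b l1 by (simp add: ea)
    also have "\<dots> \<le> 1 / (real l * exp a ^ l)"
    proof -
      have "exp a ^ l \<le> exp a ^ 1"
        using assms lb ea by (intro power_decreasing) auto
      then show ?thesis using l1 by (intro divide_left_mono mult_left_mono) auto
    qed
    finally have "r\<^sup>2 \<le> (well_coord l a)\<^sup>2"
      using well_coord_sq[OF assms, of a] by (smt (verit) exp_gt_zero)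
    moreover have "well_coord l a \<le> 0"
      using lb ea well_factor_pos[OF assms, of a] 
      by (simp add: well_coord_def mult_nonpos_nonneg)
    ultimately have "\<bar>r\<bar> \<le> - well_coord l a"
      by (metis abs_of_nonpos abs_le_square_iff)
    then show ?thesis by linarith
  qed
  moreover have "a \<le> ln b"
  proof -
    have "a \<le> 0" unfolding a_def using lb by simp
    also have "0 \<le> ln b" using b by simp
    finally show ?thesis .
  qed
  ultimately have "\<exists>s. a \<le> s \<and> s \<le> ln b \<and> well_coord l s = r"
    by (intro IVT) (auto intro: cont)
  then show "well_coord l (SOME s. well_coord l s = r) = r"
    by (metis (mono_tags, lifting) someI)
qed

lemma inj_well_coord:
  assumes "l > 0" shows "inj (well_coord l)"
proof (rule strict_mono_imp_inj_on, rule strict_monoI)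
  show "well_coord l s < well_coord l t" if "s < t" for s t
    using that by (rule DERIV_pos_imp_increasing)
      (metis has_derivative_well_coord[OF assms] well_coord'_pos[OF assms])
qed

text \<open>
  The number \<open>\<rho>\<^sup>2\<close> is the value of \<open>y\<^sup>2\<close> at which \<open>h\<^sup>2 / y^(2 l) + y\<^sup>2\<close> is minimal.  With \<open>y\<^sup>2 = \<rho>\<^sup>2 exp s\<close>, the
  sum \<open>x\<^sup>2 + y\<^sup>2\<close> becomes \<open>\<rho>\<^sup>2 (W(s) + 1 + 1 / l)\<close>, so that on points with a given sign of \<open>y\<close> the
  fiber is a circle in the coordinates \<open>(\<rho> q, z)\<close>.
\<close>

lemma fiber_iff_energy:
  assumes "l > 0" "h \<noteq> 0" "\<rho> > 0" and \<rho>: "\<rho> ^ (2 * Suc l) = real l * h\<^sup>2"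
  shows "v \<in> fiber l (h, c) \<longleftrightarrow> v$2 \<noteq> 0 \<and> v$1 = h / (v$2)^l \<and>
     (\<rho> * well_coord l (ln ((v$2)\<^sup>2 / \<rho>\<^sup>2)))\<^sup>2 + (v$3)\<^sup>2 = 2 * c - \<rho>\<^sup>2 * (1 + 1 / real l)"
proof -
  have 1: "v$1 * (v$2)^l = h \<longleftrightarrow> v$2 \<noteq> 0 \<and> v$1 = h / (v$2)^l"
    using assms(1,2) by (auto simp: field_simps)
  have 2: "(\<rho> * well_coord l (ln ((v$2)\<^sup>2 / \<rho>\<^sup>2)))\<^sup>2
      = (v$1)\<^sup>2 + (v$2)\<^sup>2 - \<rho>\<^sup>2 * (1 + 1 / real l)"
    if y: "v$2 \<noteq> 0" and x: "v$1 = h / (v$2)^l"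
  proof -
    have e: "exp (ln ((v$2)\<^sup>2 / \<rho>\<^sup>2)) = (v$2)\<^sup>2 / \<rho>\<^sup>2" using y assms by simp
    have "\<rho>\<^sup>2 * (1 / (real l * ((v$2)\<^sup>2 / \<rho>\<^sup>2) ^ l)) = \<rho>\<^sup>2 * (\<rho>\<^sup>2) ^ l / (real l * ((v$2)\<^sup>2) ^ l)"
      by (simp add: power_divide)
    also have "\<rho>\<^sup>2 * (\<rho>\<^sup>2) ^ l = real l * h\<^sup>2"
      using \<rho> by (simp only: power_mult power_Suc)
    also have "real l * h\<^sup>2 / (real l * ((v$2)\<^sup>2) ^ l) = (v$1)\<^sup>2"
      using assms(1) by (simp add: x power_divide power_mult[symmetric] mult.commute)
    finally have "(v$1)\<^sup>2 = \<rho>\<^sup>2 * (1 / (real l * ((v$2)\<^sup>2 / \<rho>\<^sup>2) ^ l))" ..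
    moreover have "\<rho>\<^sup>2 * ((v$2)\<^sup>2 / \<rho>\<^sup>2) = (v$2)\<^sup>2" using assms by simp
    ultimately show ?thesis
      unfolding power_mult_distrib well_coord_sq[OF assms(1)] e
      by (simp add: right_diff_distrib distrib_left)
  qed
  show ?thesis
    using 1 2 by (auto simp: fiber_def EC_def)
qed

lemma inv_well_coord:
  assumes "l > 0"
  shows "well_coord l (inv (well_coord l) t) = t" "inv (well_coord l) (well_coord l s) = s"
    "(inv (well_coord l) has_real_derivative 1 / well_coord' l (inv (well_coord l) t)) (at t)"
proof -
  note d = has_derivative_well_coord[OF assms] and p = well_coord'_pos[OF assms] 
    and s = surj_well_coord[OF assms]
  show "well_coord l (inv (well_coord l) t) = t" "inv (well_coord l) (well_coord l s) = s"
    using s inj_well_coord[OF assms] by (simp_all add: surj_f_inv_f)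
  obtain g where g: "\<And>x. g (well_coord l x) = x" 
    "\<And>y. (g has_real_derivative 1 / well_coord' l (g y)) (at y)"
    using increasing_C1_bijection_inverse[OF d p s] by metis
  have "inv (well_coord l) = g" using g(1) s by (metis ext surj_f_inv_f)
  with g show "(inv (well_coord l) has_real_derivative 1 / well_coord' l (inv (well_coord l) t)) (at t)"
    by simp
qed

section \<open>Level curves of positive radius\<close>

lemma ex_well_depth:
  fixes h :: real
  assumes "l > 0" "h \<noteq> 0"
  obtains \<rho> where "\<rho> > 0" "\<rho> ^ (2 * Suc l) = real l * h\<^sup>2"
proof
  show "root (2 * Suc l) (real l * h\<^sup>2) > 0"
    using assms by (simp add: real_root_gt_zero)
  show "root (2 * Suc l) (real l * h\<^sup>2) ^ (2 * Suc l) = real l * h\<^sup>2"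
    by (rule real_root_pow_pos2) auto
qed

text \<open>
  The radius of the level circle is \<open>\<rho> r\<close>.  The case of radius zero is excluded here because
  the angle on the circle is the parameter of the curve.
\<close>

locale rattleback_level =
  fixes l :: nat and h c \<rho> r :: real
  assumes l_pos: "l > 0" and h_nz: "h \<noteq> 0"
    and \<rho>_pos: "\<rho> > 0" and \<rho>_eq: "\<rho> ^ (2 * Suc l) = real l * h\<^sup>2"
    and r_pos: "r > 0" and r_eq: "(\<rho> * r)\<^sup>2 = 2 * c - \<rho>\<^sup>2 * (1 + 1 / real l)"
begin

text \<open>
  The coordinate \<open>s = ln (y\<^sup>2 / \<rho>\<^sup>2)\<close> of the point at angle \<open>\<theta>\<close>.
\<close>

definition log_height :: "real \<Rightarrow> real" where
  "log_height \<theta> = inv (well_coord l) (r * cos \<theta>)"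

text \<open>
  The parameter \<open>y\<close> is \<open>\<rho>\<close> or \<open>- \<rho>\<close> and selects one of the two pieces of the fiber.
\<close>

definition level_param :: "real \<Rightarrow> real \<Rightarrow> real^3" where
  "level_param y \<theta> =
     vector [h / (y * exp (log_height \<theta> / 2)) ^ l, y * exp (log_height \<theta> / 2), \<rho> * r * sin \<theta>]"

definition level_piece :: "real \<Rightarrow> (real^3) set" where
  "level_piece y = {v \<in> fiber l (h, c). y * v$2 > 0}"

definition level_angle :: "real^3 \<Rightarrow> complex" where
  "level_angle v = Complex (well_coord l (ln ((v$2)\<^sup>2 / \<rho>\<^sup>2)) / r) (v$3 / (\<rho> * r))"

lemma well_coord_log_height: "well_coord l (log_height \<theta>) = r * cos \<theta>"
  by (simp add: log_height_def inv_well_coord[OF l_pos])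

lemma has_derivative_log_height:
  "(log_height has_real_derivative - r * sin \<theta> / well_coord' l (log_height \<theta>)) (at \<theta>)"
  unfolding log_height_def[abs_def]
  by (rule DERIV_cong, rule DERIV_chain2[OF inv_well_coord(3)[OF l_pos]])
     (auto intro!: derivative_eq_intros simp: l_pos)

lemma level_param_height:
  assumes "\<bar>y\<bar> = \<rho>"
  shows "(y * exp (s / 2))\<^sup>2 = \<rho>\<^sup>2 * exp s"
proof -
  have "y\<^sup>2 = \<rho>\<^sup>2" using assms by (metis power2_abs)
  moreover have "(exp (s / 2))\<^sup>2 = exp s" by (simp add: exp_double[symmetric])
  ultimately show ?thesis by (simp add: power_mult_distrib)
qed

text \<open>
  This is the statement that the flow rotates the circle with angular velocity
  \<open>2 \<rho> q'(s)\<close>.  The first two components express \<open>s' = - 2 z\<close>; the third one is the force law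
  \<open>z' = 2 \<rho>\<^sup>2 q q'\<close>.
\<close>

lemma has_vector_derivative_level_param:
  assumes "\<bar>y\<bar> = \<rho>"
  shows "(level_param y has_vector_derivative
    (1 / (2 * \<rho> * well_coord' l (log_height \<theta>))) *\<^sub>R rattleback l (level_param y \<theta>)) (at \<theta>)"
proof -
  define s where "s = log_height \<theta>"
  define w where "w = well_coord' l s"
  define Y where "Y = y * exp (s / 2)"
  define s' where "s' = - r * sin \<theta> / w"
  have w: "w > 0" unfolding w_def by (rule well_coord'_pos[OF l_pos])
  have y: "y \<noteq> 0" using assms \<rho>_pos by auto
  then have Y: "Y \<noteq> 0" by (simp add: Y_def)
  have ds: "(log_height has_real_derivative s') (at \<theta>)"
    using has_derivative_log_height unfolding s'_def w_def s_def .
  have dY: "((\<lambda>\<theta>. y * exp (log_height \<theta> / 2)) has_real_derivative Y * s' / 2) (at \<theta>)"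
    by (auto intro!: derivative_eq_intros ds simp: Y_def s_def)
  have pow: "Y ^ l = Y * Y ^ (l - 1)" using l_pos by (cases l) auto
  have dX: "((\<lambda>\<theta>. h / (y * exp (log_height \<theta> / 2)) ^ l) has_real_derivative
      - (real l / 2) * s' * (h / Y ^ l)) (at \<theta>)"
  proof -
    have "((\<lambda>\<theta>. (y * exp (log_height \<theta> / 2)) ^ l) has_real_derivative real l * Y ^ l * s' / 2) (at \<theta>)"
      by (rule DERIV_cong[OF DERIV_power[OF dY]]) (simp add: pow s_def[symmetric] Y_def[symmetric])
    note quot = DERIV_divide[OF DERIV_const[of h] this, folded s_def, folded Y_def]
    show ?thesis
      by (rule DERIV_cong[OF quot]) (use Y in simp_all)
  qed
  have dZ: "((\<lambda>\<theta>. \<rho> * r * sin \<theta>) has_real_derivative \<rho> * r * cos \<theta>) (at \<theta>)"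
    by (auto intro!: derivative_eq_intros)
  have Y2: "Y\<^sup>2 = \<rho>\<^sup>2 * exp s" using level_param_height[OF assms] by (simp add: Y_def)
  have "(Y ^ l)\<^sup>2 = (Y\<^sup>2) ^ l" by (metis power_mult mult.commute)
  then have "real l * (h / Y ^ l)\<^sup>2 = \<rho> ^ (2 * Suc l) / (Y\<^sup>2) ^ l"
    by (simp only: \<rho>_eq power_divide times_divide_eq_right)
  also have "\<dots> = \<rho>\<^sup>2 / exp s ^ l"
    unfolding Y2 power_mult power_Suc power_mult_distrib using \<rho>_pos by simp
  finally have "Y\<^sup>2 - real l * (h / Y ^ l)\<^sup>2 = \<rho>\<^sup>2 * (exp s - 1 / exp s ^ l)"
    by (simp add: Y2 right_diff_distrib)
  also have "\<dots> = 2 * \<rho> * w * (\<rho> * r * cos \<theta>)"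
    unfolding well_coord_times_deriv[OF l_pos, symmetric]
    by (simp add: s_def w_def well_coord_log_height power2_eq_square)
  finally have force: "Y\<^sup>2 - real l * (h / Y ^ l)\<^sup>2 = 2 * \<rho> * w * (\<rho> * r * cos \<theta>)" .
  have "(1 / (2 * \<rho> * w)) *\<^sub>R rattleback l (level_param y \<theta>)
      = vector [- (real l / 2) * s' * (h / Y ^ l), Y * s' / 2, \<rho> * r * cos \<theta>]"
    unfolding rattleback_def level_param_def vector_3 s_def[symmetric] Y_def[symmetric] force
    using w \<rho>_pos by (simp add: vec_eq_iff forall_3 s'_def mult.commute mult.left_commute)
  then show ?thesis
    using has_vector_derivative_vector_3[OF dX dY dZ]
    unfolding w_def s_def level_param_def[abs_def] by metis
qed

lemma level_angle_param:
  assumes "\<bar>y\<bar> = \<rho>"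
  shows "level_angle (level_param y \<theta>) = cis \<theta>"
proof -
  have "ln ((level_param y \<theta> $ 2)\<^sup>2 / \<rho>\<^sup>2) = log_height \<theta>"
    using \<rho>_pos by (simp add: level_param_def level_param_height[OF assms])
  then show ?thesis
    using r_pos \<rho>_pos
    by (simp add: level_angle_def well_coord_log_height complex_eq_iff) (simp add: level_param_def)
qed

lemma level_piece_iff:
  assumes "\<bar>y\<bar> = \<rho>"
  shows "v \<in> level_piece y \<longleftrightarrow> y * v$2 > 0 \<and> v$1 = h / (v$2)^l \<and> level_angle v \<in> S1"
proof -
  define q where "q = well_coord l (ln ((v$2)\<^sup>2 / \<rho>\<^sup>2))"
  have "level_angle v \<in> S1 \<longleftrightarrow> (q / r)\<^sup>2 + (v$3 / (\<rho> * r))\<^sup>2 = 1"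
    by (simp add: level_angle_def q_def cmod_def)
  also have "\<dots> \<longleftrightarrow> (\<rho> * q)\<^sup>2 + (v$3)\<^sup>2 = (\<rho> * r)\<^sup>2"
    using \<rho>_pos r_pos by (auto simp: field_simps power_mult_distrib)
  finally show ?thesis
    unfolding level_piece_def mem_Collect_eq fiber_iff_energy[OF l_pos h_nz \<rho>_pos \<rho>_eq]
      q_def r_eq by auto
qed

text \<open>
  The image of the compact interval gives compactness of the piece, and the image of the line
  identifies it with an orbit.
\<close>

lemma level_piece_eq_image:
  assumes "\<bar>y\<bar> = \<rho>"
  shows "level_piece y = level_param y ` {0..2 * pi}" "level_piece y = range (level_param y)"
proof -
  have y: "y \<noteq> 0" using assms \<rho>_pos by auto
  have 1: "range (level_param y) \<subseteq> level_piece y"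
  proof (clarsimp simp: level_piece_iff[OF assms] level_angle_param[OF assms])
    fix \<theta>
    have "y * (y * exp (log_height \<theta> / 2)) = y\<^sup>2 * exp (log_height \<theta> / 2)"
      by (simp add: power2_eq_square)
    also have "\<dots> > 0" using y by simp
    finally show "0 < y * level_param y \<theta> $ 2 \<and> level_param y \<theta> $ 1 = h / level_param y \<theta> $ 2 ^ l"
      by (simp add: level_param_def)
  qed
  have 2: "level_piece y \<subseteq> level_param y ` {0..2 * pi}"
  proof
    fix v assume v: "v \<in> level_piece y"
    then have v': "y * v$2 > 0" "v$1 = h / (v$2)^l" "cmod (level_angle v) = 1"
      by (auto simp: level_piece_iff[OF assms])
    from v' have v2: "v$2 \<noteq> 0" by auto
    define s where "s = ln ((v$2)\<^sup>2 / \<rho>\<^sup>2)"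
    have "(well_coord l s / r)\<^sup>2 + (v$3 / (\<rho> * r))\<^sup>2 = 1"
      using v'(3) by (simp add: level_angle_def s_def cmod_def)
    then obtain \<theta> where \<theta>: "0 \<le> \<theta>" "\<theta> < 2 * pi" "well_coord l s / r = cos \<theta>" "v$3 / (\<rho> * r) = sin \<theta>"
      using sincos_total_2pi by metis
    have ws: "well_coord l s = r * cos \<theta>" using \<theta>(3) r_pos by (simp add: field_simps)
    have z: "v$3 = \<rho> * r * sin \<theta>" using \<theta>(4) r_pos \<rho>_pos by (simp add: field_simps)
    have lh: "log_height \<theta> = s"
      unfolding log_height_def ws[symmetric] by (rule inv_well_coord[OF l_pos])
    have "(y * exp (s / 2))\<^sup>2 = (v$2)\<^sup>2"
      using v2 \<rho>_pos by (simp add: level_param_height[OF assms] s_def)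
    then have "y * exp (s / 2) = v$2 \<or> y * exp (s / 2) = - v$2"
      by (simp add: power2_eq_iff)
    moreover have "y * exp (s / 2) \<noteq> - v$2"
    proof
      assume "y * exp (s / 2) = - v$2"
      then have "y * v$2 = - (y\<^sup>2 * exp (s / 2))"
        by (simp add: power2_eq_square algebra_simps minus_equation_iff[of _ "v$2"])
      then show False using v'(1) y by (smt (verit) exp_gt_zero mult_nonneg_nonneg zero_le_power2)
    qed
    ultimately have "v = level_param y \<theta>"
      using v'(2) z by (simp add: vec_eq_iff forall_3 level_param_def lh)
    with \<theta> show "v \<in> level_param y ` {0..2 * pi}" by auto
  qed
  from 1 2 show "level_piece y = level_param y ` {0..2 * pi}" "level_piece y = range (level_param y)"
    by blast+
qed

lemma periodic_orbit_level_piece: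
  assumes "\<bar>y\<bar> = \<rho>"
  shows "periodic_orbit (rattleback l) (level_piece y)"
proof -
  let ?g = "\<lambda>\<theta>. 2 * \<rho> * well_coord' l (log_height \<theta>)"
  have pos: "?g \<theta> > 0" for \<theta>
    using well_coord'_pos[OF l_pos] \<rho>_pos by simp
  have per: "log_height (\<theta> + 2 * pi) = log_height \<theta>" for \<theta>
    by (simp add: log_height_def)
  have "isCont (well_coord' l) s" for s
    unfolding well_coord'_def[abs_def] well_factor_def[abs_def]
    using well_factor_pos[OF l_pos, of s] l_pos
    by (intro continuous_intros) (auto simp: well_factor_def)
  then have "isCont (\<lambda>\<theta>. well_coord' l (log_height \<theta>)) \<theta>" for \<theta>
    by (rule isCont_o2[OF DERIV_isCont[OF has_derivative_log_height]])
  then have cont: "isCont ?g \<theta>" for \<theta>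
    by (intro continuous_intros)
  have nonconst: "level_angle (level_param y 0) \<noteq> level_angle (level_param y pi)"
    unfolding level_angle_param[OF assms] by simp
  show ?thesis
    unfolding level_piece_eq_image(2)[OF assms]
  proof (rule periodic_orbit_if_parametrized[where P = "2 * pi", OF cont pos _ _ _ has_vector_derivative_level_param[OF assms]])
    show "level_param y 0 \<noteq> level_param y pi" using nonconst by metis
    show "rattleback l (level_param y \<theta>) = ?g \<theta> *\<^sub>R (1 / ?g \<theta>) *\<^sub>R rattleback l (level_param y \<theta>)" for \<theta>
      using \<rho>_pos well_coord'_pos[OF l_pos, of "log_height \<theta>"] by simp
  qed (simp_all add: per level_param_def)
qed

text \<open>
  The piece is compact, so it suffices that the angle is a continuous bijection onto the circle;
  it is injective because \<open>well_coord\<close> is, and because the sign of \<open>y\<close> is fixed on a piece.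
\<close>

lemma level_piece_homeomorphic_circle:
  assumes "\<bar>y\<bar> = \<rho>"
  shows "S1 homeomorphic level_piece y"
proof -
  have "continuous_on {0..2 * pi} (level_param y)"
    using has_vector_derivative_level_param[OF assms]
    by (meson continuous_at_imp_continuous_on has_vector_derivative_continuous)
  then have comp: "compact (level_piece y)"
    unfolding level_piece_eq_image(1)[OF assms] by (intro compact_continuous_image) auto
  have nz: "v$2 \<noteq> 0" if "v \<in> level_piece y" for v
    using that by (auto simp: level_piece_def)
  have contw: "continuous_on UNIV (well_coord l)"
    using has_derivative_well_coord[OF l_pos] DERIV_isCont continuous_at_imp_continuous_on by blast
  have cont: "continuous_on (level_piece y) level_angle"
    unfolding level_angle_def Complex_eq using r_pos \<rho>_pos nz
    by (intro continuous_intros continuous_on_compose2[OF contw]) auto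
  have "level_angle ` level_piece y = range cis"
    unfolding level_piece_eq_image(2)[OF assms] image_image level_angle_param[OF assms] ..
  also have "range cis = S1"
  proof (intro equalityI subsetI)
    fix w assume "w \<in> S1"
    then have "cmod w = 1" by simp
    moreover from this have "w \<noteq> 0" by auto
    ultimately have "w = cis (Arg w)" by (simp add: cis_Arg sgn_eq)
    then show "w \<in> range cis" by blast
  qed auto
  finally have im: "level_angle ` level_piece y = S1" .
  have inj: "inj_on level_angle (level_piece y)"
  proof (rule inj_onI)
    fix v w assume v: "v \<in> level_piece y" and w: "w \<in> level_piece y"
      and eq: "level_angle v = level_angle w"
    have "ln ((v$2)\<^sup>2 / \<rho>\<^sup>2) = ln ((w$2)\<^sup>2 / \<rho>\<^sup>2)"
      using eq r_pos injD[OF inj_well_coord[OF l_pos]] by (auto simp: level_angle_def)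
    then have "(v$2)\<^sup>2 / \<rho>\<^sup>2 = (w$2)\<^sup>2 / \<rho>\<^sup>2"
      using nz[OF v] nz[OF w] \<rho>_pos by (subst (asm) ln_inj_iff) auto
    then have "(v$2)\<^sup>2 = (w$2)\<^sup>2" using \<rho>_pos by simp
    moreover have "y * v$2 > 0" "y * w$2 > 0" using v w by (auto simp: level_piece_def)
    ultimately have "v$2 = w$2" by (auto simp: power2_eq_iff)
    moreover have "v$3 = w$3" using eq r_pos \<rho>_pos by (simp add: level_angle_def)
    ultimately show "v = w"
      using v w by (simp add: vec_eq_iff forall_3 level_piece_iff[OF assms])
  qed
  from homeomorphism_compact[OF comp cont im inj] show ?thesis
    using homeomorphic_def homeomorphic_sym by blast
qed

lemma fiber_two_periodic_orbits:
  "top_of_set (fiber l (h, c)) homeomorphic_space two_circles \<and>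
   (\<exists>A B. periodic_orbit (rattleback l) A \<and> periodic_orbit (rattleback l) B \<and>
          A \<inter> B = {} \<and> fiber l (h, c) = A \<union> B)"
proof -
  have U: "fiber l (h, c) = level_piece \<rho> \<union> level_piece (- \<rho>)"
    using \<rho>_pos fiber_iff_energy[OF l_pos h_nz \<rho>_pos \<rho>_eq]
    by (auto simp: level_piece_def mult_less_0_iff zero_less_mult_iff)
  have disj: "level_piece \<rho> \<inter> level_piece (- \<rho>) = {}"
    using \<rho>_pos by (auto simp: level_piece_def mult_less_0_iff zero_less_mult_iff)
  have "\<bar>\<rho>\<bar> = \<rho>" "\<bar>- \<rho>\<bar> = \<rho>" using \<rho>_pos by auto
  note circles = level_piece_homeomorphic_circle[OF this(1)] level_piece_homeomorphic_circle[OF this(2)]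
    and orbits = periodic_orbit_level_piece[OF this(1)] periodic_orbit_level_piece[OF this(2)]
  show ?thesis
    unfolding U
    by (intro conjI exI[of _ "level_piece \<rho>"] exI[of _ "level_piece (- \<rho>)"]
        homeomorphic_space_two_circles circles orbits disj refl)
qed

end

section \<open>The periodic and the stable strata\<close>

text \<open>
  Taking roots of degree \<open>l + 1\<close> in the inequality for \<open>h\<^sup>2\<close> turns it into
  \<open>\<rho>\<^sup>2 (1 + 1 / l) < 2 c\<close>, which is positivity of the squared radius.
\<close>

lemma fiber_periodic_stratum:
  assumes "l > 0" "h \<noteq> 0" "c > 0"
    and less: "h\<^sup>2 < real l ^ l * (2 / (real l + 1)) ^ (l + 1) * c ^ (l + 1)"
  obtains \<rho> r where "rattleback_level l h c \<rho> r"
proof -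
  obtain \<rho> where \<rho>: "\<rho> > 0" "\<rho> ^ (2 * Suc l) = real l * h\<^sup>2"
    using ex_well_depth[OF assms(1,2)] .
  have "(\<rho>\<^sup>2) ^ Suc l = real l * h\<^sup>2" using \<rho>(2) by (simp only: power_mult)
  also have "\<dots> < real l * (real l ^ l * (2 / (real l + 1)) ^ (l + 1) * c ^ (l + 1))"
    using less assms(1) by (intro mult_strict_left_mono) auto
  also have "\<dots> = (real l * (2 / (real l + 1)) * c) ^ Suc l"
    unfolding power_mult_distrib by simp
  finally have "\<rho>\<^sup>2 < real l * (2 / (real l + 1)) * c"
    by (rule power_less_imp_less_base) (use assms in auto)
  then have "\<rho>\<^sup>2 * (1 + 1 / real l) < 2 * c"
    using assms by (simp add: field_simps)
  then have "rattleback_level l h c \<rho> (sqrt (2 * c - \<rho>\<^sup>2 * (1 + 1 / real l)) / \<rho>)"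
    by unfold_locales (use assms \<rho> in auto)
  then show ?thesis by (rule that)
qed

text \<open>
  At such a point \<open>y\<^sup>2 = l x\<^sup>2\<close>, so \<open>y\<^sup>2\<close> is the value \<open>\<rho>\<^sup>2\<close> at the minimum and the level circle has radius
  zero.
\<close>

lemma fiber_stable_stratum:
  assumes "l > 0" "M \<noteq> 0" "\<bar>y\<bar> = \<bar>M\<bar> * sqrt (real l)"
    and hc: "(h, c) = EC l (vector [M, y, 0])"
  shows "\<exists>p q. p \<noteq> q \<and> fiber l (h, c) = {p, q} \<and>
               lyapunov_stable (rattleback l) p \<and> lyapunov_stable (rattleback l) q"
proof -
  define \<rho> where "\<rho> = \<bar>M\<bar> * sqrt (real l)"
  have \<rho>: "\<rho> > 0" using assms by (simp add: \<rho>_def)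
  have y2: "y\<^sup>2 = \<rho>\<^sup>2" using assms(3) by (metis power2_abs \<rho>_def)
  have \<rho>2: "\<rho>\<^sup>2 = real l * M\<^sup>2" by (simp add: \<rho>_def power_mult_distrib)
  have h: "h = M * y ^ l" and c: "2 * c = M\<^sup>2 + y\<^sup>2" using hc by (auto simp: EC_def)
  have "y \<noteq> 0" using assms by auto
  then have h0: "h \<noteq> 0" using h assms by simp
  have "real l * h\<^sup>2 = \<rho>\<^sup>2 * (y\<^sup>2) ^ l"
    by (simp add: h \<rho>2 power_mult_distrib power_mult[symmetric] mult.commute)
  then have \<rho>_eq: "\<rho> ^ (2 * Suc l) = real l * h\<^sup>2" by (simp only: y2 power_mult power_Suc)
  have c0: "2 * c - \<rho>\<^sup>2 * (1 + 1 / real l) = 0"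
    unfolding c y2 \<rho>2 using assms(1) by (simp add: field_simps)
  have w0: "well_coord l 0 = 0" by (simp add: well_coord_def)
  have fib: "v \<in> fiber l (h, c) \<longleftrightarrow> (v$2 = \<rho> \<or> v$2 = - \<rho>) \<and> v$1 = h / (v$2)^l \<and> v$3 = 0" for v
  proof -
    have "well_coord l (ln ((v$2)\<^sup>2 / \<rho>\<^sup>2)) = 0 \<longleftrightarrow> (v$2)\<^sup>2 = \<rho>\<^sup>2" if "v$2 \<noteq> 0"
    proof -
      have "well_coord l (ln ((v$2)\<^sup>2 / \<rho>\<^sup>2)) = 0 \<longleftrightarrow> ln ((v$2)\<^sup>2 / \<rho>\<^sup>2) = 0"
        using w0 inj_eq[OF inj_well_coord[OF assms(1)]] by metis
      also have "\<dots> \<longleftrightarrow> (v$2)\<^sup>2 = \<rho>\<^sup>2"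
        using that \<rho> by auto
      finally show ?thesis .
    qed
    then show ?thesis
      unfolding fiber_iff_energy[OF assms(1) h0 \<rho> \<rho>_eq] c0
      using \<rho> by (auto simp: sum_power2_eq_zero_iff power2_eq_iff)
  qed
  let ?p = "vector [h / \<rho> ^ l, \<rho>, 0] :: real^3" and ?q = "vector [h / (- \<rho>) ^ l, - \<rho>, 0] :: real^3"
  have F: "fiber l (h, c) = {?p, ?q}"
    by (auto simp: fib vec_eq_iff forall_3)
  have neq: "?p \<noteq> ?q" using \<rho> by (simp add: vec_eq_iff forall_3)
  have "\<rho>\<^sup>2 = real l * (h / x ^ l)\<^sup>2" if "x\<^sup>2 = \<rho>\<^sup>2" for x
  proof -
    have "(x ^ l)\<^sup>2 = (\<rho>\<^sup>2) ^ l" by (metis that power_mult mult.commute)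
    then have "real l * (h / x ^ l)\<^sup>2 = \<rho> ^ (2 * Suc l) / (\<rho>\<^sup>2) ^ l"
      by (simp only: \<rho>_eq power_divide times_divide_eq_right)
    also have "\<dots> = \<rho>\<^sup>2" using \<rho> by (simp add: power_mult power2_eq_square[of \<rho>])
    finally show ?thesis ..
  qed
  from this[of \<rho>] this[of "- \<rho>"]
  have "equilibrium (rattleback l) ?p" "equilibrium (rattleback l) ?q"
    by (simp_all add: equilibrium_def rattleback_def vec_eq_iff forall_3)
  moreover have "EC l ?p = (h, c)" "EC l ?q = (h, c)"
    using F by (auto simp: fiber_def)
  ultimately have "lyapunov_stable (rattleback l) ?p" "lyapunov_stable (rattleback l) ?q"
    using F by (auto intro!: isolated_in_fiber_imp_lyapunov_stable)
  then show ?thesis using F neq by blast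
qed

section \<open>Great circles through the poles\<close>

text \<open>
  Coordinates of the plane spanned by the \<open>i\<close>-th and the third axis.  This treats the
  planes \<open>x = 0\<close> and \<open>y = 0\<close> alike.
\<close>

definition frame :: "3 \<Rightarrow> real \<Rightarrow> real \<Rightarrow> real^3" where
  "frame i u w = u *\<^sub>R axis i 1 + w *\<^sub>R axis 3 1"

definition meridian :: "3 \<Rightarrow> real \<Rightarrow> (real^3) set" where
  "meridian i m = {frame i u w | u w. u\<^sup>2 + w\<^sup>2 = m\<^sup>2}"

text \<open>
  Only the sign of \<open>a\<close> matters; it selects the side of the third axis.
\<close>

definition half_meridian :: "3 \<Rightarrow> real \<Rightarrow> real \<Rightarrow> (real^3) set" where
  "half_meridian i m a = {frame i u w | u w. u\<^sup>2 + w\<^sup>2 = m\<^sup>2 \<and> a * u > 0}"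

text \<open>
  A parametrization of a half meridian by the whole line that is also a solution of the
  rattleback system for a suitable rate \<open>k\<close>.
\<close>

definition sech_arc :: "3 \<Rightarrow> real \<Rightarrow> real \<Rightarrow> real \<Rightarrow> real \<Rightarrow> real^3" where
  "sech_arc i k m a t = frame i (a / cosh (k * t)) (m * tanh (k * t))"

lemma frame_nth [simp]: "i \<noteq> 3 \<Longrightarrow> frame i u w $ i = u" "i \<noteq> 3 \<Longrightarrow> frame i u w $ 3 = w"
  "j \<noteq> i \<Longrightarrow> j \<noteq> 3 \<Longrightarrow> frame i u w $ j = 0"
  by (auto simp: frame_def axis_def)

lemma frame_eq_iff [simp]: "i \<noteq> 3 \<Longrightarrow> frame i u w = frame i u' w' \<longleftrightarrow> u = u' \<and> w = w'"
  by (metis frame_nth(1,2))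

lemma continuous_on_frame [continuous_intros]:
  "continuous_on S f \<Longrightarrow> continuous_on S g \<Longrightarrow> continuous_on S (\<lambda>x. frame i (f x) (g x))"
  unfolding frame_def by (intro continuous_intros)

lemma frame_vector: "frame 1 u w = vector [u, 0, w]" "frame 2 u w = vector [0, u, w]"
  by (auto simp: vec_eq_iff forall_3 frame_def axis_def)

lemma meridian_homeomorphic_circle:
  assumes "i \<noteq> 3" "m > 0"
  shows "meridian i m homeomorphic S1"
proof -
  let ?f = "\<lambda>w. frame i (m * Re w) (m * Im w)"
  have im: "?f ` S1 = meridian i m"
  proof (intro equalityI subsetI)
    fix v assume "v \<in> ?f ` S1"
    then obtain w where w: "v = ?f w" "cmod w = 1" by auto
    have "(Re w)\<^sup>2 + (Im w)\<^sup>2 = 1" using w(2) by (simp add: cmod_def)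
    then have "(m * Re w)\<^sup>2 + (m * Im w)\<^sup>2 = m\<^sup>2"
      unfolding power_mult_distrib by (metis distrib_left mult.right_neutral)
    then show "v \<in> meridian i m" using w unfolding meridian_def by blast
  next
    fix v assume "v \<in> meridian i m"
    then obtain u w where v: "v = frame i u w" "u\<^sup>2 + w\<^sup>2 = m\<^sup>2" by (auto simp: meridian_def)
    have "(u / m)\<^sup>2 + (w / m)\<^sup>2 = 1"
      using v(2) assms(2) by (simp add: power_divide add_divide_distrib[symmetric])
    then have "Complex (u / m) (w / m) \<in> S1" by (simp add: cmod_def)
    moreover have "v = ?f (Complex (u / m) (w / m))" using v assms by simp
    ultimately show "v \<in> ?f ` S1" by blast
  qed
  have "continuous_on S1 ?f" by (intro continuous_intros)
  moreover have "inj_on ?f S1" using assms by (auto simp: inj_on_def complex_eq_iff)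
  ultimately have "S1 homeomorphic meridian i m"
    using homeomorphism_compact[of S1 ?f, OF compact_sphere _ im] homeomorphic_def by blast
  then show ?thesis by (rule homeomorphic_sym[THEN iffD1])
qed

lemma sech_sq: "(1 / cosh x)\<^sup>2 = 1 - (tanh x)\<^sup>2" for x :: real
proof -
  have "1 - (tanh x)\<^sup>2 = ((cosh x)\<^sup>2 - (sinh x)\<^sup>2) / (cosh x)\<^sup>2"
    by (simp add: tanh_def power_divide diff_divide_distrib)
  then show ?thesis by (simp add: hyperbolic_pythagoras power_divide)
qed

lemma ex_tanh_eq:
  assumes "\<bar>c\<bar> < 1" obtains x :: real where "tanh x = c"
proof
  have c: "1 + c > 0" "1 - c > 0" using assms by auto
  have "exp (- 2 * (ln ((1 + c) / (1 - c)) / 2)) = (1 - c) / (1 + c)"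
    using c by (simp add: exp_minus)
  then show "tanh (ln ((1 + c) / (1 - c)) / 2) = c"
    unfolding tanh_real_altdef by (simp only:) (use c in \<open>simp add: field_simps\<close>)
qed

text \<open>
  The third coordinate determines the time, since \<open>tanh\<close> is onto the open interval from -1 to 1, and it
  determines the other coordinate up to sign, since \<open>1 / cosh\<^sup>2 + tanh\<^sup>2 = 1\<close>.
\<close>

lemma range_sech_arc:
  assumes "i \<noteq> 3" "m > 0" "\<bar>a\<bar> = m" "k \<noteq> 0"
  shows "range (sech_arc i k m a) = half_meridian i m a"
proof (intro equalityI subsetI)
  have a2: "a\<^sup>2 = m\<^sup>2" using assms(3) by (metis power2_abs)
  have a0: "a \<noteq> 0" using assms by auto
  have on_circle: "(a / cosh x)\<^sup>2 + (m * tanh x)\<^sup>2 = m\<^sup>2" for x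
  proof -
    have "(a / cosh x)\<^sup>2 = m\<^sup>2 * (1 / cosh x)\<^sup>2" by (simp add: power_divide a2)
    then show ?thesis by (simp only: sech_sq power_mult_distrib) (simp add: algebra_simps)
  qed
  have sign: "a * (a / cosh x) > 0" for x
    using a0 cosh_real_pos[of x] by (auto simp: zero_less_mult_iff zero_less_divide_iff)
  {
    fix v assume "v \<in> range (sech_arc i k m a)"
    then show "v \<in> half_meridian i m a"
      using on_circle sign unfolding sech_arc_def half_meridian_def by blast
  next
    fix v assume "v \<in> half_meridian i m a"
    then obtain u w where v: "v = frame i u w" "u\<^sup>2 + w\<^sup>2 = m\<^sup>2" "a * u > 0"
      by (auto simp: half_meridian_def)
    have "u\<^sup>2 > 0" using v(3) by auto
    then have "w\<^sup>2 < m\<^sup>2" using v(2) by linarith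
    then have "\<bar>w\<bar> < m" using assms(2) by (intro power2_less_imp_less[of "\<bar>w\<bar>"]) auto
    then have "\<bar>w / m\<bar> < 1" using assms(2) by simp
    then obtain x where x: "tanh x = w / m" by (rule ex_tanh_eq)
    have w: "m * tanh x = w" using x assms(2) by simp
    have "(a / cosh x)\<^sup>2 = u\<^sup>2" using on_circle[of x] v(2) by (simp add: w)
    then have "a / cosh x = u \<or> a / cosh x = - u" by (simp add: power2_eq_iff)
    then have "a / cosh x = u" 
      using sign[of x] v(3) by (metis mult_minus_right neg_0_less_iff_less order_less_asym)
    then have "v = sech_arc i k m a (x / k)"
      using w v(1) assms(4) by (simp add: sech_arc_def)
    then show "v \<in> range (sech_arc i k m a)" by blast
  }
qed

text \<open>
  The half meridian is homeomorphic to the line, with \<open>artanh\<close> of the normalized third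
  coordinate as inverse parametrization.
\<close>

lemma half_meridian_homeomorphic_interval:
  assumes "i \<noteq> 3" "m > 0" "\<bar>a\<bar> = m"
  shows "half_meridian i m a homeomorphic {0<..<1::real}" "connected (half_meridian i m a)"
proof -
  note R = range_sech_arc[OF assms, of 1, simplified]
  have cont: "continuous_on UNIV (sech_arc i 1 m a)"
    unfolding sech_arc_def[abs_def] by (intro continuous_intros) auto
  have "continuous_on (range (sech_arc i 1 m a)) (\<lambda>v. artanh (v$3 / m))"
  proof (rule continuous_on_compose2[OF continuous_on_artanh[OF subset_refl]])
    show "continuous_on (range (sech_arc i 1 m a)) (\<lambda>v. v$3 / m)"
      using assms(2) by (intro continuous_on_divide continuous_on_component continuous_on_id) auto
    show "(\<lambda>v. v$3 / m) ` range (sech_arc i 1 m a) \<subseteq> {-1<..<1}"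
      using assms by (auto simp: sech_arc_def tanh_real_lt_1 tanh_real_gt_neg1)
  qed
  then have "homeomorphism UNIV (range (sech_arc i 1 m a)) (sech_arc i 1 m a) (\<lambda>v. artanh (v$3 / m))"
    by (intro homeomorphismI cont) (use assms in \<open>auto simp: sech_arc_def artanh_tanh_real\<close>)
  then have "(UNIV :: real set) homeomorphic half_meridian i m a"
    unfolding R homeomorphic_def by blast
  moreover have "{0<..<1::real} homeomorphic (UNIV :: real set)"
    by (rule homeomorphic_open_interval_UNIV) simp
  ultimately show "half_meridian i m a homeomorphic {0<..<1::real}"
    by (meson homeomorphic_sym homeomorphic_trans)
  show "connected (half_meridian i m a)"
    unfolding R[symmetric] by (intro connected_continuous_image cont connected_UNIV)
qed

section \<open>Heteroclinic orbits and the unstable stratum\<close>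

lemma has_vector_derivative_sech_arc:
  "(sech_arc i k m a has_vector_derivative
      frame i (- (k * (a / cosh (k * t)) * tanh (k * t))) (k * m * (1 / cosh (k * t))\<^sup>2)) (at t)"
proof -
  have c: "cosh (k * t) \<noteq> 0" by simp
  have 1: "((\<lambda>t. a / cosh (k * t)) has_real_derivative - (k * (a / cosh (k * t)) * tanh (k * t))) (at t)"
    using c by (auto intro!: derivative_eq_intros simp: tanh_def power2_eq_square)
  have 2: "((\<lambda>t. m * tanh (k * t)) has_real_derivative k * m * (1 / cosh (k * t))\<^sup>2) (at t)"
    unfolding sech_sq using c by (auto intro!: derivative_eq_intros)
  show ?thesis
    unfolding sech_arc_def[abs_def] frame_def
    using has_vector_derivative_add[OF
        has_vector_derivative_scaleR[OF 1 has_vector_derivative_const[of "axis i 1 :: real^3"]]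
        has_vector_derivative_scaleR[OF 2 has_vector_derivative_const[of "axis 3 1 :: real^3"]]]
    by (simp only: scaleR_zero_right add_0_left)
qed

text \<open>
  On the plane \<open>x = 0\<close> the system is \<open>y' = - y z\<close>, \<open>z' = y\<^sup>2\<close>; on the plane \<open>y = 0\<close> it is
  \<open>x' = l x z\<close>, \<open>z' = - l x\<^sup>2\<close>, which is the same system with time rescaled by \<open>- l\<close>.
\<close>

lemma solution_sech_arc:
  assumes "a\<^sup>2 = m\<^sup>2"
  shows "solution_on (rattleback l) (sech_arc 2 m m a) UNIV"
    "solution_on (rattleback l) (sech_arc 1 (- real l * m) m a) UNIV"
proof -
  have sq: "(a / cosh x)\<^sup>2 = m * m * (1 / cosh x)\<^sup>2" for x
    using assms by (simp add: power_divide power2_eq_square)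
  have 2: "rattleback l (sech_arc 2 m m a t)
      = frame 2 (- (m * (a / cosh (m * t)) * tanh (m * t))) (m * m * (1 / cosh (m * t))\<^sup>2)" for t
    unfolding sech_arc_def frame_vector rattleback_def vector_3 sq by (simp add: ac_simps)
  have 1: "rattleback l (sech_arc 1 k m a t)
      = frame 1 (- (k * (a / cosh (k * t)) * tanh (k * t))) (k * m * (1 / cosh (k * t))\<^sup>2)"
    if k: "k = - real l * m" for k t
    unfolding sech_arc_def frame_vector rattleback_def vector_3 sq by (simp add: k ac_simps)
  show "solution_on (rattleback l) (sech_arc 2 m m a) UNIV"
    unfolding solution_on_def 2 using has_vector_derivative_sech_arc by blast
  show "solution_on (rattleback l) (sech_arc 1 (- real l * m) m a) UNIV"
    unfolding solution_on_def 1[OF refl] using has_vector_derivative_sech_arc by blast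
qed

lemma sech_arc_limits:
  fixes F :: "real filter"
  assumes "filterlim (\<lambda>t. k * t) at_top F"
  shows "(sech_arc i k m a \<longlongrightarrow> frame i 0 m) F"
proof -
  have "((\<lambda>t. a / cosh (k * t)) \<longlongrightarrow> 0) F"
    by (intro real_tendsto_divide_at_top[OF tendsto_const] filterlim_compose[OF cosh_real_at_top assms])
  moreover have "((\<lambda>t. m * tanh (k * t)) \<longlongrightarrow> m * 1) F"
    by (intro tendsto_intros filterlim_compose[OF tanh_real_at_top assms])
  ultimately show ?thesis
    unfolding sech_arc_def frame_def by (intro tendsto_add tendsto_scaleR tendsto_const) simp_all
qed

lemma sech_arc_limits_bot:
  fixes F :: "real filter"
  assumes "filterlim (\<lambda>t. k * t) at_bot F"
  shows "(sech_arc i k m a \<longlongrightarrow> frame i 0 (- m)) F"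
proof -
  have "sech_arc i k m a = sech_arc i (- k) (- m) a"
    by (auto simp: sech_arc_def fun_eq_iff)
  moreover have "filterlim (\<lambda>t. - k * t) at_top F"
    using assms by (simp add: filterlim_uminus_at_top)
  ultimately show ?thesis using sech_arc_limits by metis
qed

text \<open>
  The rate is positive in the plane \<open>x = 0\<close> and negative in the plane \<open>y = 0\<close>, so the two kinds of
  orbits connect the poles in opposite directions.
\<close>

lemma heteroclinic_half_meridians:
  assumes "l > 0" "m > 0" "\<bar>a\<bar> = m"
  shows "heteroclinic_orbit_from_to (rattleback l) (vector [0, 0, - m]) (vector [0, 0, m]) (half_meridian 2 m a)"
    and "heteroclinic_orbit_from_to (rattleback l) (vector [0, 0, m]) (vector [0, 0, - m]) (half_meridian 1 m a)"
proof -
  have eq: "equilibrium (rattleback l) (vector [0, 0, z])" for z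
    by (simp add: equilibrium_def rattleback_def vec_eq_iff forall_3)
  have ne: "(vector [0, 0, m] :: real^3) \<noteq> vector [0, 0, - m]"
    using assms by (simp add: vec_eq_iff forall_3)
  have a2: "a\<^sup>2 = m\<^sup>2" using assms(3) by (metis power2_abs)
  have lm: "- real l * m < 0" using assms by simp
  have lim: "filterlim (\<lambda>t. m * t) at_top at_top" "filterlim (\<lambda>t. m * t) at_bot at_bot"
    using assms by (auto intro: filterlim_tendsto_pos_mult_at_top[OF tendsto_const _ filterlim_ident]
        filterlim_tendsto_pos_mult_at_bot[OF tendsto_const _ filterlim_ident])
  have "filterlim (\<lambda>t. real l * m * t) at_top at_top"
    using lm by (intro filterlim_tendsto_pos_mult_at_top[OF tendsto_const _ filterlim_ident]) auto
  then have lim': "filterlim (\<lambda>t. - real l * m * t) at_bot at_top" "filterlim (\<lambda>t. - real l * m * t) at_top at_bot"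
    by (simp_all add: filterlim_uminus_at_top filterlim_at_bot_mirror)
  show "heteroclinic_orbit_from_to (rattleback l) (vector [0, 0, - m]) (vector [0, 0, m]) (half_meridian 2 m a)"
    unfolding heteroclinic_orbit_from_to_def
    using eq ne solution_sech_arc(1)[OF a2] range_sech_arc[of 2 m a m] assms
      sech_arc_limits[OF lim(1), of 2 m a] sech_arc_limits_bot[OF lim(2), of 2 m a]
    by (intro conjI exI[of _ "sech_arc 2 m m a"]) (auto simp: frame_vector)
  show "heteroclinic_orbit_from_to (rattleback l) (vector [0, 0, m]) (vector [0, 0, - m]) (half_meridian 1 m a)"
    unfolding heteroclinic_orbit_from_to_def
    using eq ne solution_sech_arc(2)[OF a2] range_sech_arc[of 1 m a "- real l * m"] assms
      sech_arc_limits_bot[OF lim'(1), of 1 m a] sech_arc_limits[OF lim'(2), of 1 m a]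
    by (intro conjI exI[of _ "sech_arc 1 (- real l * m) m a"]) (auto simp: frame_vector)
qed

lemma heteroclinic_cycle_of_pair:
  assumes A: "heteroclinic_orbit_from_to f p q A" and B: "heteroclinic_orbit_from_to f q p B"
  shows "heteroclinic_cycle f ({p, q} \<union> A \<union> B)"
proof -
  let ?p = "\<lambda>i::nat. if i = 0 then p else q" and ?A = "\<lambda>i::nat. if i = 0 then A else B"
  have "p \<noteq> q" using A by (simp add: heteroclinic_orbit_from_to_def)
  have two: "{..<2::nat} = {0, 1}" by auto
  have "inj_on ?p {..<2}" using \<open>p \<noteq> q\<close> by (simp add: two)
  moreover have "\<forall>i<2. heteroclinic_orbit_from_to f (?p i) (?p (Suc i mod 2)) (?A i)"
    using A B by (auto simp: less_2_cases_iff)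
  moreover have "{p, q} \<union> A \<union> B = (\<Union>i<2. insert (?p i) (?A i))"
    by (auto simp: two)
  ultimately show ?thesis
    unfolding heteroclinic_cycle_def
    by (intro exI[of _ "2::nat"] exI[of _ ?p] exI[of _ ?A]) simp
qed

lemma heteroclinic_stratum_fiber:
  assumes l: "l > 0" and m: "m > 0"
  shows "fiber l (0, m\<^sup>2 / 2) = meridian 2 m \<union> meridian 1 m"
proof (intro equalityI subsetI)
  fix v assume "v \<in> fiber l (0, m\<^sup>2 / 2)"
  then have "v$1 = 0 \<or> v$2 = 0" "(v$1)\<^sup>2 + (v$2)\<^sup>2 + (v$3)\<^sup>2 = m\<^sup>2"
    by (auto simp: fiber_def EC_def)
  then have "(v = frame 2 (v$2) (v$3) \<and> (v$2)\<^sup>2 + (v$3)\<^sup>2 = m\<^sup>2) \<or>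
      (v = frame 1 (v$1) (v$3) \<and> (v$1)\<^sup>2 + (v$3)\<^sup>2 = m\<^sup>2)"
    by (auto simp: vec_eq_iff forall_3)
  then show "v \<in> meridian 2 m \<union> meridian 1 m"
    unfolding meridian_def by blast
next
  fix v assume "v \<in> meridian 2 m \<union> meridian 1 m"
  then show "v \<in> fiber l (0, m\<^sup>2 / 2)"
    using l by (auto simp: meridian_def fiber_def EC_def)
qed

lemma meridian_decomposition:
  assumes "i \<noteq> 3" "m > 0"
  shows "meridian i m = {frame i 0 m, frame i 0 (- m)} \<union> half_meridian i m m \<union> half_meridian i m (- m)"
proof (intro equalityI subsetI)
  fix v assume "v \<in> meridian i m"
  then obtain u w where v: "v = frame i u w" "u\<^sup>2 + w\<^sup>2 = m\<^sup>2" by (auto simp: meridian_def)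
  consider "u = 0" "w = m \<or> w = - m" | "m * u > 0" | "- m * u > 0"
    using v(2) assms(2) by (cases u "0::real" rule: linorder_cases) (auto simp: power2_eq_iff zero_less_mult_iff mult_less_0_iff)
  then show "v \<in> {frame i 0 m, frame i 0 (- m)} \<union> half_meridian i m m \<union> half_meridian i m (- m)"
    using v unfolding half_meridian_def by cases blast+
qed (use assms(1) in \<open>auto simp: meridian_def half_meridian_def\<close>)

lemma half_meridian_nonempty:
  assumes "m > 0" "\<bar>a\<bar> = m"
  shows "frame i a 0 \<in> half_meridian i m a"
proof -
  have "a\<^sup>2 = m\<^sup>2" using assms(2) by (metis power2_abs)
  moreover have "a * a > 0" using assms by (auto simp: zero_less_mult_iff)
  ultimately show ?thesis unfolding half_meridian_def by force
qed

text \<open>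
  Removing the poles leaves four half meridians.  Each is cut out of the remaining set by an open half space,
  because a point of one great circle off the poles has a nonzero coordinate that vanishes on
  the other.
\<close>

lemma components_heteroclinic_fiber:
  assumes m: "m > 0"
  defines "\<A> \<equiv> {half_meridian 2 m m, half_meridian 2 m (- m), half_meridian 1 m m, half_meridian 1 m (- m)}"
  defines "S \<equiv> (meridian 2 m \<union> meridian 1 m) - {vector [0, 0, m], vector [0, 0, - m]}"
  shows "components S = \<A>" "card \<A> = 4"
proof -
  have poles: "vector [0, 0, z] \<notin> half_meridian i m a" if "i \<in> {1, 2}" for i a z
    using that by (auto simp: half_meridian_def frame_vector vec_eq_iff forall_3)
  have U: "\<Union>\<A> = S"
    using meridian_decomposition[of 1 m] meridian_decomposition[of 2 m] m poles
    unfolding \<A>_def S_def by (auto simp: frame_vector)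
  have sep: "half_meridian i m a \<inter> half_meridian j m b = {}"
    if "i \<in> {1, 2}" "j \<in> {1, 2}" "i \<noteq> j \<or> a = - b" for i j a b
    using that by (auto simp: half_meridian_def frame_vector vec_eq_iff forall_3
        zero_less_mult_iff mult_less_0_iff)
  have ne: "half_meridian i m m \<noteq> {}" "half_meridian i m (- m) \<noteq> {}" for i
    using half_meridian_nonempty[of m m i] half_meridian_nonempty[of m "- m" i] m by auto
  have d: "half_meridian 2 m m \<inter> half_meridian 2 m (- m) = {}"
    "half_meridian 2 m m \<inter> half_meridian 1 m m = {}"
    "half_meridian 2 m m \<inter> half_meridian 1 m (- m) = {}"
    "half_meridian 2 m (- m) \<inter> half_meridian 1 m m = {}"
    "half_meridian 2 m (- m) \<inter> half_meridian 1 m (- m) = {}"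
    "half_meridian 1 m m \<inter> half_meridian 1 m (- m) = {}"
    by (rule sep; simp)+
  have disj: "pairwise disjnt \<A>"
    unfolding \<A>_def pairwise_insert disjnt_def using d by (auto simp only: Int_commute pairwise_empty)
  have neq: "A \<noteq> B" if "A \<inter> B = {}" "A \<noteq> {}" for A B :: "(real^3) set"
    using that by auto
  show "card \<A> = 4"
    unfolding \<A>_def using d[THEN neq] ne by simp
  have op: "openin (top_of_set S) (half_meridian i m a)"
    if "i \<in> {1, 2}" "half_meridian i m a \<in> \<A>" for i a
  proof -
    have "half_meridian i m a = S \<inter> {v. a * v$i > 0}"
    proof (intro equalityI subsetI)
      fix v assume v: "v \<in> half_meridian i m a"
      then have "a * v$i > 0" using that(1) by (auto simp: half_meridian_def)
      then show "v \<in> S \<inter> {v. a * v$i > 0}" using U that v by blast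
    next
      fix v assume v: "v \<in> S \<inter> {v. a * v$i > 0}"
      then obtain j u w where j: "j \<in> {1, 2}" "v = frame j u w" "u\<^sup>2 + w\<^sup>2 = m\<^sup>2"
        by (auto simp: S_def meridian_def)
      have "j = i" using v j(1,2) that(1) by auto
      then show "v \<in> half_meridian i m a"
        using v j that(1) by (auto simp: half_meridian_def)
    qed
    moreover have "open {v :: real^3. a * v$i > 0}"
      by (intro open_Collect_less continuous_intros)
    ultimately show ?thesis by (metis openin_open)
  qed
  show "components S = \<A>"
  proof (rule components_eq_if_disjoint_open[OF U disj])
    show "openin (top_of_set S) A" if "A \<in> \<A>" for A
      using op[of 1 m] op[of 1 "- m"] op[of 2 m] op[of 2 "- m"] that unfolding \<A>_def by auto
    show "connected A" if "A \<in> \<A>" for A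
      using that m unfolding \<A>_def by (auto intro!: half_meridian_homeomorphic_interval)
    show "{} \<notin> \<A>" unfolding \<A>_def using ne by (metis empty_iff insert_iff)
  qed
qed

text \<open>
  One half meridian in the plane \<open>x = 0\<close> and one in the plane \<open>y = 0\<close> form a cycle, since they are traversed
  in opposite directions; two such cycles exhaust the fiber.
\<close>

lemma fiber_unstable_stratum:
  assumes l: "l > 0" and m: "m > 0"
  shows "(\<exists>C D p q. fiber l (0, m\<^sup>2 / 2) = C \<union> D \<and> C homeomorphic S1 \<and> D homeomorphic S1 \<and>
           C \<inter> D = {p, q} \<and> p \<noteq> q \<and>
           unstable_equilibrium (rattleback l) p \<and> unstable_equilibrium (rattleback l) q \<and>
           card (components (fiber l (0, m\<^sup>2 / 2) - {p, q})) = 4 \<and>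
           (\<forall>A \<in> components (fiber l (0, m\<^sup>2 / 2) - {p, q}).
              A homeomorphic {0<..<1::real} \<and>
              heteroclinic_orbit_connecting (rattleback l) p q A)) \<and>
         (\<exists>\<H>. (\<forall>H\<in>\<H>. heteroclinic_cycle (rattleback l) H) \<and> fiber l (0, m\<^sup>2 / 2) = \<Union>\<H>)"
proof -
  let ?p = "vector [0, 0, m] :: real^3" and ?q = "vector [0, 0, - m] :: real^3"
  let ?f = "rattleback l"
  note F = heteroclinic_stratum_fiber[OF l m]
  have up: "heteroclinic_orbit_from_to ?f ?q ?p (half_meridian 2 m a)"
    and down: "heteroclinic_orbit_from_to ?f ?p ?q (half_meridian 1 m a)" if "\<bar>a\<bar> = m" for a
    using heteroclinic_half_meridians[OF l m that] by auto
  have am: "\<bar>m\<bar> = m" "\<bar>- m\<bar> = m" using m by auto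
  have int: "meridian 2 m \<inter> meridian 1 m = {?p, ?q}"
    using m by (auto simp: meridian_def frame_vector vec_eq_iff forall_3 power2_eq_iff)
  have ne: "?p \<noteq> ?q" using m by (simp add: vec_eq_iff forall_3)
  have unst: "unstable_equilibrium ?f ?p" "unstable_equilibrium ?f ?q"
    using up[OF am(1)] down[OF am(1)] heteroclinic_source_unstable by blast+
  have arcs: "A homeomorphic {0<..<1::real} \<and> heteroclinic_orbit_connecting ?f ?p ?q A"
    if "A \<in> components (meridian 2 m \<union> meridian 1 m - {?p, ?q})" for A
    using that up[OF am(1)] up[OF am(2)] down[OF am(1)] down[OF am(2)]
      half_meridian_homeomorphic_interval(1)[OF _ m am(1)] half_meridian_homeomorphic_interval(1)[OF _ m am(2)]
    unfolding components_heteroclinic_fiber(1)[OF m] heteroclinic_orbit_connecting_def by auto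
  have "heteroclinic_cycle ?f ({?q, ?p} \<union> half_meridian 2 m a \<union> half_meridian 1 m a)" if "\<bar>a\<bar> = m" for a
    using heteroclinic_cycle_of_pair[OF up[OF that] down[OF that]] .
  then have cycles: "\<forall>H \<in> {{?q, ?p} \<union> half_meridian 2 m m \<union> half_meridian 1 m m,
      {?q, ?p} \<union> half_meridian 2 m (- m) \<union> half_meridian 1 m (- m)}. heteroclinic_cycle ?f H"
    using am by simp
  have union: "meridian 2 m \<union> meridian 1 m = \<Union>{{?q, ?p} \<union> half_meridian 2 m m \<union> half_meridian 1 m m,
      {?q, ?p} \<union> half_meridian 2 m (- m) \<union> half_meridian 1 m (- m)}"
    using meridian_decomposition[of 1 m] meridian_decomposition[of 2 m] m
    by (auto simp: frame_vector)
  have circles: "meridian 2 m homeomorphic S1" "meridian 1 m homeomorphic S1"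
    using m by (auto intro: meridian_homeomorphic_circle)
  have card: "card (components (meridian 2 m \<union> meridian 1 m - {?p, ?q})) = 4"
    using components_heteroclinic_fiber[OF m] by simp
  show ?thesis
    unfolding F
  proof (rule conjI)
    show "\<exists>C D p q. meridian 2 m \<union> meridian 1 m = C \<union> D \<and> C homeomorphic S1 \<and> D homeomorphic S1 \<and>
           C \<inter> D = {p, q} \<and> p \<noteq> q \<and> unstable_equilibrium ?f p \<and> unstable_equilibrium ?f q \<and>
           card (components (meridian 2 m \<union> meridian 1 m - {p, q})) = 4 \<and>
           (\<forall>A \<in> components (meridian 2 m \<union> meridian 1 m - {p, q}).
              A homeomorphic {0<..<1::real} \<and> heteroclinic_orbit_connecting ?f p q A)"
      by (intro exI[of _ "meridian 2 m"] exI[of _ "meridian 1 m"] exI[of _ ?p] exI[of _ ?q] conjI ballI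
          refl circles int ne unst card arcs[THEN conjunct1] arcs[THEN conjunct2])
    show "\<exists>\<H>. (\<forall>H\<in>\<H>. heteroclinic_cycle ?f H) \<and> meridian 2 m \<union> meridian 1 m = \<Union>\<H>"
      by (intro exI conjI) (rule cycles, rule union)
  qed
qed

section \<open>Topology and dynamics of all fibers\<close>

theorem proposition6p1:
  fixes l :: nat and h c :: real
  assumes "l > 1"
    and "(h, c) \<in> range (EC l)"
  shows
    "((h, c) \<in> Sigma_p_plus l \<or> (h, c) \<in> Sigma_p_minus l \<longrightarrow>
        top_of_set (fiber l (h, c)) homeomorphic_space two_circles \<and>
        (\<exists>A B. periodic_orbit (rattleback l) A \<and> periodic_orbit (rattleback l) B \<and>
               A \<inter> B = {} \<and> fiber l (h, c) = A \<union> B))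
     \<and>
     ((h, c) \<in> Sigma_s_plus_star l \<or> (h, c) \<in> Sigma_s_minus_star l \<longrightarrow>
        (\<exists>p q. p \<noteq> q \<and> fiber l (h, c) = {p, q} \<and>
               lyapunov_stable (rattleback l) p \<and> lyapunov_stable (rattleback l) q))
     \<and>
     ((h, c) \<in> Sigma_u l \<longrightarrow>
        (\<exists>C D p q. fiber l (h, c) = C \<union> D \<and> C homeomorphic S1 \<and> D homeomorphic S1 \<and>
               C \<inter> D = {p, q} \<and> p \<noteq> q \<and>
               unstable_equilibrium (rattleback l) p \<and> unstable_equilibrium (rattleback l) q \<and>
               card (components (fiber l (h, c) - {p, q})) = 4 \<and>
               (\<forall>A \<in> components (fiber l (h, c) - {p, q}).
                  A homeomorphic {0<..<1::real} \<and>
                  heteroclinic_orbit_connecting (rattleback l) p q A)) \<and>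
        (\<exists>\<H>. (\<forall>H\<in>\<H>. heteroclinic_cycle (rattleback l) H) \<and> fiber l (h, c) = \<Union>\<H>))
     \<and>
     ((h, c) \<in> Sigma_s_0 l \<longrightarrow>
        fiber l (h, c) = {vector [0, 0, 0]} \<and>
        lyapunov_stable (rattleback l) (vector [0, 0, 0]))"
proof (rule conjI[OF impI conjI[OF impI conjI[OF impI impI]]])
  have l: "l > 0" using assms(1) by simp
  {
    assume "(h, c) \<in> Sigma_p_plus l \<or> (h, c) \<in> Sigma_p_minus l"
    then have "h \<noteq> 0" "c > 0" "h\<^sup>2 < real l ^ l * (2 / (real l + 1)) ^ (l + 1) * c ^ (l + 1)"
      by (auto simp: Sigma_p_plus_def Sigma_p_minus_def)
    then obtain \<rho> r where "rattleback_level l h c \<rho> r"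
      using fiber_periodic_stratum[OF l] by blast
    then show "top_of_set (fiber l (h, c)) homeomorphic_space two_circles \<and>
        (\<exists>A B. periodic_orbit (rattleback l) A \<and> periodic_orbit (rattleback l) B \<and>
               A \<inter> B = {} \<and> fiber l (h, c) = A \<union> B)"
      by (rule rattleback_level.fiber_two_periodic_orbits)
  next
    assume "(h, c) \<in> Sigma_s_plus_star l \<or> (h, c) \<in> Sigma_s_minus_star l"
    then have "(h, c) \<in> EC l ` E_s_star l"
      by (auto simp: Sigma_s_plus_star_def Sigma_s_minus_star_def)
    then obtain M y where "M \<noteq> 0" "y = M * sqrt (real l) \<or> y = - M * sqrt (real l)"
      "(h, c) = EC l (vector [M, y, 0])"
      unfolding E_s_star_def by blast
    moreover from this have "\<bar>y\<bar> = \<bar>M\<bar> * sqrt (real l)"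
      by (auto simp: abs_mult)
    ultimately show "\<exists>p q. p \<noteq> q \<and> fiber l (h, c) = {p, q} \<and>
               lyapunov_stable (rattleback l) p \<and> lyapunov_stable (rattleback l) q"
      using fiber_stable_stratum[OF l] by blast
  next
    assume "(h, c) \<in> Sigma_u l"
    then obtain M where M: "M \<noteq> 0" "(h, c) = EC l (vector [0, 0, M])"
      unfolding Sigma_u_def E_u_def by blast
    then have hc: "h = 0" "c = \<bar>M\<bar>\<^sup>2 / 2" and "\<bar>M\<bar> > 0"
      by (auto simp: EC_def)
    show "(\<exists>C D p q. fiber l (h, c) = C \<union> D \<and> C homeomorphic S1 \<and> D homeomorphic S1 \<and>
               C \<inter> D = {p, q} \<and> p \<noteq> q \<and>
               unstable_equilibrium (rattleback l) p \<and> unstable_equilibrium (rattleback l) q \<and>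
               card (components (fiber l (h, c) - {p, q})) = 4 \<and>
               (\<forall>A \<in> components (fiber l (h, c) - {p, q}).
                  A homeomorphic {0<..<1::real} \<and>
                  heteroclinic_orbit_connecting (rattleback l) p q A)) \<and>
        (\<exists>\<H>. (\<forall>H\<in>\<H>. heteroclinic_cycle (rattleback l) H) \<and> fiber l (h, c) = \<Union>\<H>)"
      unfolding hc by (rule fiber_unstable_stratum[OF l \<open>\<bar>M\<bar> > 0\<close>])
  next
    assume "(h, c) \<in> Sigma_s_0 l"
    then have "h = 0" "c = 0" by (auto simp: Sigma_s_0_def E_s_0_def EC_def)
    moreover have "v = vector [0, 0, 0]" if "(v$1)\<^sup>2 + (v$2)\<^sup>2 + (v$3)\<^sup>2 = 0" for v :: "real^3"
      using that by (simp add: vec_eq_iff forall_3 add_nonneg_eq_0_iff)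
    ultimately have fib: "fiber l (h, c) = {vector [0, 0, 0]}"
      using l by (auto simp: fiber_def EC_def)
    then have "EC l (vector [0, 0, 0]) = (h, c)" by (auto simp: fiber_def)
    moreover have "equilibrium (rattleback l) (vector [0, 0, 0])"
      by (simp add: equilibrium_def rattleback_def vec_eq_iff forall_3)
    ultimately have "lyapunov_stable (rattleback l) (vector [0, 0, 0])"
      using fib by (intro isolated_in_fiber_imp_lyapunov_stable) auto
    with fib show "fiber l (h, c) = {vector [0, 0, 0]} \<and>
        lyapunov_stable (rattleback l) (vector [0, 0, 0])" by simp
  }
qed

end
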